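(* Let $r$ be a positive integer and let $G$ be an $r$-regular plane multigraph with no odd cut of size smaller than $r$, whose (planar) dual is a partial $3$-tree. Then $G$ is $r$-edge-colorable.
   Context: A multigraph may have parallel edges. An odd cut of $G$ is the set of edges with exactly one end in $X$ for some $X\subseteq V(G)$ with $|X|$ odd. The dual of a plane multigraph has a vertex for each face and an edge crossing each edge of $G$. A partial $3$-tree is a graph of treewidth at most $3$ (a subgraph of a graph obtained from $K_4$ by repeatedly adding a vertex adjacent to all vertices of an existing triangle). $G$ is $r$-edge-colorable if its edges can be colored with $r$ colors so that edges sharing an endpoint receive distinct colors. *)

theory Defs
  imports "HOL-Analysis.Analysis"
begin

record ('v, 'e) multigraph =
  verts :: "'v set"
  edges :: "'e set"
  ends :: "'e \<Rightarrow> 'v set"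

text \<open>An edge with a single end is a loop. Loops are needed for duals (a bridge gives a dual loop).
  Counting a loop twice in the degree, an \<open>r\<close>-regular multigraph whose odd cuts have size at
  least \<open>r\<close> is loopless: consider the cut around a single vertex.\<close>

definition multigraph :: "('v, 'e) multigraph \<Rightarrow> bool" where
  "multigraph G \<longleftrightarrow> finite (verts G) \<and> finite (edges G) \<and>
     (\<forall>e \<in> edges G. ends G e \<subseteq> verts G \<and> card (ends G e) \<in> {1, 2})"

definition degree :: "('v, 'e) multigraph \<Rightarrow> 'v \<Rightarrow> nat" where
  "degree G v = card {e \<in> edges G. v \<in> ends G e} + card {e \<in> edges G. ends G e = {v}}"

definition regular_multigraph :: "nat \<Rightarrow> ('v, 'e) multigraph \<Rightarrow> bool" where
  "regular_multigraph r G \<longleftrightarrow> (\<forall>v \<in> verts G. degree G v = r)"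

definition cut :: "('v, 'e) multigraph \<Rightarrow> 'v set \<Rightarrow> 'e set" where
  "cut G X = {e \<in> edges G. \<exists>u v. ends G e = {u, v} \<and> u \<in> X \<and> v \<notin> X}"

definition odd_cut :: "('v, 'e) multigraph \<Rightarrow> 'e set \<Rightarrow> bool" where
  "odd_cut G C \<longleftrightarrow> (\<exists>X \<subseteq> verts G. odd (card X) \<and> C = cut G X)"

definition edge_colorable :: "nat \<Rightarrow> ('v, 'e) multigraph \<Rightarrow> bool" where
  "edge_colorable r G \<longleftrightarrow> (\<exists>c :: 'e \<Rightarrow> nat. (\<forall>e \<in> edges G. c e < r) \<and>
     (\<forall>e \<in> edges G. \<forall>e' \<in> edges G. e \<noteq> e' \<and> ends G e \<inter> ends G e' \<noteq> {} \<longrightarrow> c e \<noteq> c e'))"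

text \<open>A plane multigraph: the vertices are points of the plane, and \<open>\<gamma> e\<close> parametrizes the edge
  \<open>e\<close> as a simple curve (closed exactly for loops). Its interior \<open>\<gamma> e ` {0<..<1}\<close> meets neither
  a vertex nor another edge.\<close>

definition plane_multigraph :: "(complex, 'e) multigraph \<Rightarrow> ('e \<Rightarrow> real \<Rightarrow> complex) \<Rightarrow> bool" where
  "plane_multigraph G \<gamma> \<longleftrightarrow> multigraph G \<and>
     (\<forall>e \<in> edges G. simple_path (\<gamma> e) \<and> {pathstart (\<gamma> e), pathfinish (\<gamma> e)} = ends G e \<and>
        \<gamma> e ` {0<..<1} \<inter> verts G = {} \<and>
        (\<forall>e' \<in> edges G. e' \<noteq> e \<longrightarrow> \<gamma> e ` {0<..<1} \<inter> path_image (\<gamma> e') = {}))"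

definition faces :: "(complex, 'e) multigraph \<Rightarrow> ('e \<Rightarrow> real \<Rightarrow> complex) \<Rightarrow> complex set set" where
  "faces G \<gamma> = components (- (verts G \<union> (\<Union>e \<in> edges G. path_image (\<gamma> e))))"

text \<open>The dual edge crossing \<open>e\<close> keeps the name \<open>e\<close>. It joins the faces on the two sides of \<open>e\<close>,
  that is, the faces having \<open>e\<close> on their boundary; it is a loop if there is only one such face.\<close>

definition plane_dual ::
    "(complex, 'e) multigraph \<Rightarrow> ('e \<Rightarrow> real \<Rightarrow> complex) \<Rightarrow> (complex set, 'e) multigraph" where
  "plane_dual G \<gamma> = \<lparr>verts = faces G \<gamma>, edges = edges G,
     ends = (\<lambda>e. {F \<in> faces G \<gamma>. \<gamma> e ` {0<..<1} \<subseteq> frontier F})\<rparr>"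

inductive three_tree :: "'v set \<Rightarrow> 'v set set \<Rightarrow> bool" where
  K4: "card W = 4 \<Longrightarrow> three_tree W {{u, v} |u v. u \<in> W \<and> v \<in> W \<and> u \<noteq> v}"
| add_vertex: "three_tree W D \<Longrightarrow> x \<notin> W \<Longrightarrow> T \<subseteq> W \<Longrightarrow> card T = 3 \<Longrightarrow>
    (\<And>u v. u \<in> T \<Longrightarrow> v \<in> T \<Longrightarrow> u \<noteq> v \<Longrightarrow> {u, v} \<in> D) \<Longrightarrow>
    three_tree (insert x W) (D \<union> {{x, t} |t. t \<in> T})"

text \<open>As usual for treewidth, loops and multiplicities of edges are ignored. The ambient 3-tree lives
  on \<^typ>\<open>nat\<close>, so that the type of vertices does not limit its size.\<close>

definition partial_three_tree :: "('v, 'e) multigraph \<Rightarrow> bool" where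
  "partial_three_tree G \<longleftrightarrow> (\<exists>(W :: nat set) D f. three_tree W D \<and>
     inj_on f (verts G) \<and> f ` verts G \<subseteq> W \<and>
     (\<forall>e \<in> edges G. \<forall>u v. ends G e = {u, v} \<and> u \<noteq> v \<longrightarrow> {f u, f v} \<in> D))"

end

(* Fix a set J of edges meeting every vertex an odd number of times, and view the dual as a signed
   graph with signature J. An r-edge-colouring of G amounts to an antipodal map of the signed double
   cover of the dual into the r-dimensional cube that sends edges to edges: if S_i is the set of
   faces whose i-th coordinate is 1, the dual cut of S_i is an even subgraph of G, so its symmetric
   difference with J has odd degree everywhere. These r sets partition the edges, and as G is
   r-regular each of them is a perfect matching.

   Shortest dual paths, with their signs, give a metric d on the double cover. A dual cycle is a cut
   of G, negative iff it is odd, so antipodal points are at distance at least r. A minimal metric of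
   this kind, with the same parities, satisfies d(x,y) + d(x,-y) = r. Hence the distances among three
   points are realized in the cube, and three realized points always extend to a fourth one: the
   equations leave one free parameter, and the triangle inequalities say exactly that its range is
   nonempty. So the map is built along the 3-tree.

   That the even subgraphs of G are the dual cuts comes from the Jordan curve theorem (a cycle is
   the dual cut of the faces inside it) and from Janiszewski's theorem: a graph with an edge e on a
   cycle K separates two points only if the graph without e or K does. *)

theory Submission
  imports Defs
begin

section \<open>Degrees, cuts and joins\<close>

text \<open>Width 3 is where the method stops. Three points of a cube are determined by their
  distances up to the symmetries of the cube, so a fourth one can be added whatever was chosen
  before. Four points are not, and the five points of K_{2,3} with its path metric satisfy every
  condition on triples for \<open>r \<ge> 3\<close> but fit isometrically into no cube, since two
  points at distance 2 have only two common neighbours there. For this reason distances are realized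
  only along the edges of the 3-tree.

  The bound 2r on the perimeter of a triple is the triangle inequality through an antipode: d(x,y)
  <= d(x,-z) + d(-z,y) = 2r - d(x,z) - d(z,y). It is how the antipodes enter once the metric is
  restricted to one copy of each face.

  In the combinatorial part, paths and cycles are replaced by edge sets with prescribed degree
  parities, added by symmetric difference; triangle inequality, parities and cycle-cut duality then
  become linear algebra over GF(2). Topology only has to supply that cycles are dual cuts and that
  the dual is connected.\<close>

lemma odd_card_sym_diff:
  assumes "finite A" "finite B"
  shows "odd (card (sym_diff A B)) \<longleftrightarrow> odd (card A) \<noteq> odd (card B)"
proof -
  have 1: "card A = card (A - B) + card (A \<inter> B)" "card B = card (B - A) + card (A \<inter> B)"
    using card_Diff_subset_Int[of A B] card_Diff_subset_Int[of B A] assms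
      card_mono[of A "A \<inter> B"] card_mono[of B "A \<inter> B"] by (auto simp: Int_commute)
  have "card (sym_diff A B) = card (A - B) + card (B - A)"
    using assms by (intro card_Un_disjoint) auto
  then show ?thesis unfolding 1 by auto
qed

lemma card_sym_diff_le:
  assumes "finite A" "finite B"
  shows "card (sym_diff A B) \<le> card A + card B"
proof -
  have "card (sym_diff A B) \<le> card (A \<union> B)" using assms by (intro card_mono) auto
  also have "\<dots> \<le> card A + card B" by (rule card_Un_le)
  finally show ?thesis .
qed

text \<open>The end map and the edge set are separate arguments, so that one notion serves the
  graph, its dual and their edge subsets. A loop counts once; for loopless graphs, which are the
  ones intended, this agrees with \<open>degree\<close>.\<close>

definition deg :: "('e \<Rightarrow> 'v set) \<Rightarrow> 'e set \<Rightarrow> 'v \<Rightarrow> nat" where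
  "deg h Z v = card {e \<in> Z. v \<in> h e}"

definition bd :: "('e \<Rightarrow> 'v set) \<Rightarrow> 'e set \<Rightarrow> 'v set \<Rightarrow> 'e set" where
  "bd h Z X = {e \<in> Z. card (h e \<inter> X) = 1}"

definition adj :: "('e \<Rightarrow> 'v set) \<Rightarrow> 'e set \<Rightarrow> ('v \<times> 'v) set" where
  "adj h Z = {(u, v). \<exists>e \<in> Z. h e = {u, v}}"

lemma deg_empty [simp]: "deg h {} v = 0"
  by (simp add: deg_def)

lemma odd_deg_sym_diff:
  assumes "finite A" "finite B"
  shows "odd (deg h (sym_diff A B) v) \<longleftrightarrow> odd (deg h A v) \<noteq> odd (deg h B v)"
proof -
  have "{e \<in> sym_diff A B. v \<in> h e} = sym_diff {e \<in> A. v \<in> h e} {e \<in> B. v \<in> h e}" by auto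
  then show ?thesis unfolding deg_def using assms by (simp add: odd_card_sym_diff)
qed

lemma odd_card_Int_sym_diff:
  assumes "finite A" "finite B"
  shows "odd (card (sym_diff A B \<inter> J)) \<longleftrightarrow> odd (card (A \<inter> J)) \<noteq> odd (card (B \<inter> J))"
proof -
  have "sym_diff A B \<inter> J = sym_diff (A \<inter> J) (B \<inter> J)" by auto
  then show ?thesis using assms by (simp add: odd_card_sym_diff)
qed

lemma odd_deg_singleton: "odd (deg h {e} v) \<longleftrightarrow> v \<in> h e"
proof -
  have "{e' \<in> {e}. v \<in> h e'} = (if v \<in> h e then {e} else {})" by auto
  then show ?thesis unfolding deg_def by auto
qed

text \<open>Summing degrees over \<open>X\<close> counts an edge once for each of its ends in
  \<open>X\<close>; modulo 2 only the edges with exactly one end in \<open>X\<close>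
  survive.\<close>

lemma handshake:
  assumes "finite Z" "finite X" "\<And>e. e \<in> Z \<Longrightarrow> card (h e) = 2"
  shows "odd (card (bd h Z X)) \<longleftrightarrow> odd (card {x \<in> X. odd (deg h Z x)})"
proof -
  have "(\<Sum>x\<in>X. deg h Z x) = (\<Sum>x\<in>X. \<Sum>e\<in>Z. if x \<in> h e then 1 else 0)"
    unfolding deg_def using assms(1) by (simp add: sum.If_cases Int_def)
  also have "\<dots> = (\<Sum>e\<in>Z. \<Sum>x\<in>X. if x \<in> h e then 1 else 0)" by (rule sum.swap)
  also have "\<dots> = (\<Sum>e\<in>Z. card (h e \<inter> X))"
    using assms(2) by (simp add: sum.If_cases Int_commute)
  finally have 1: "(\<Sum>x\<in>X. deg h Z x) = (\<Sum>e\<in>Z. card (h e \<inter> X))" .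
  have "odd (card (h e \<inter> X)) \<longleftrightarrow> card (h e \<inter> X) = 1" if "e \<in> Z" for e
  proof -
    have "finite (h e)" using assms(3)[OF that] card.infinite by fastforce
    then have "card (h e \<inter> X) \<le> 2" using assms(3)[OF that] card_mono[of "h e" "h e \<inter> X"] by auto
    then have "card (h e \<inter> X) = 0 \<or> card (h e \<inter> X) = 1 \<or> card (h e \<inter> X) = 2" by linarith
    then show ?thesis by auto
  qed
  then have 2: "{e \<in> Z. odd (card (h e \<inter> X))} = bd h Z X" unfolding bd_def by auto
  show ?thesis using even_sum_iff[OF assms(2), of "deg h Z"] even_sum_iff[OF assms(1), of "\<lambda>e. card (h e \<inter> X)"]
    unfolding 1 2 by auto
qed

lemma card_2_Int_eq_1:
  assumes "u \<noteq> v"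
  shows "card ({u, v} \<inter> X) = 1 \<longleftrightarrow> (u \<in> X) \<noteq> (v \<in> X)"
proof -
  have "{u, v} \<inter> X = (if u \<in> X then {u} else {}) \<union> (if v \<in> X then {v} else {})" by auto
  then show ?thesis using assms by auto
qed

lemma bd_Int: "J \<subseteq> E \<Longrightarrow> bd h E X \<inter> J = bd h J X"
  unfolding bd_def by auto

lemma bd_reach_empty:
  assumes "\<And>e. e \<in> Z \<Longrightarrow> card (h e) = 2"
  shows "bd h Z {v. (u, v) \<in> (adj h Z)\<^sup>*} = {}"
proof -
  have False if e: "e \<in> Z" and c: "card (h e \<inter> {v. (u, v) \<in> (adj h Z)\<^sup>*}) = 1" for e
  proof -
    obtain x y where xy: "h e = {x, y}" "x \<noteq> y" using assms[OF e] by (meson card_2_iff)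
    have "(x, y) \<in> adj h Z" "(y, x) \<in> adj h Z" using e xy unfolding adj_def by auto
    then have "(u, x) \<in> (adj h Z)\<^sup>* \<longleftrightarrow> (u, y) \<in> (adj h Z)\<^sup>*" by (meson rtrancl.rtrancl_into_rtrancl)
    then show False using c card_2_Int_eq_1[OF xy(2)] unfolding xy by simp
  qed
  then show ?thesis unfolding bd_def by blast
qed

text \<open>The edges of a walk are added one by one by symmetric difference. Edges used twice
  cancel, so the walk need not be made simple; only degree parities are kept.\<close>

lemma path_join:
  assumes "(u, v) \<in> (adj h Z)\<^sup>*" "\<And>e. e \<in> Z \<Longrightarrow> card (h e) = 2"
  shows "\<exists>P. P \<subseteq> Z \<and> finite P \<and> (\<forall>x. odd (deg h P x) \<longleftrightarrow> (x = u) \<noteq> (x = v))"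
  using assms(1)
proof (induction rule: rtrancl_induct)
  case base
  then show ?case by (intro exI[of _ "{}"]) auto
next
  case (step y z)
  then obtain P where P: "P \<subseteq> Z" "finite P" "\<And>x. odd (deg h P x) \<longleftrightarrow> (x = u) \<noteq> (x = y)" by auto
  obtain e where e: "e \<in> Z" "h e = {y, z}" using step unfolding adj_def by auto
  then have "y \<noteq> z" using assms(2)[OF e(1)] by auto
  then show ?case using P e
    by (intro exI[of _ "sym_diff P {e}"]) (auto simp: odd_deg_sym_diff[OF P(2)] odd_deg_singleton)
qed

text \<open>Take \<open>J\<close> with the fewest vertices of even degree. The component of such a
  vertex has an empty cut, hence even order by \<open>cuts\<close>; by the handshake lemma it has an
  even number of bad vertices, so a second one, and adding a path between the two repairs
  both.\<close>

lemma join_exists: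
  fixes h :: "'e \<Rightarrow> 'v set"
  assumes "finite V" "finite E" and h: "\<And>e. e \<in> E \<Longrightarrow> h e \<subseteq> V \<and> card (h e) = 2"
    and cuts: "\<And>X. X \<subseteq> V \<Longrightarrow> odd (card X) \<Longrightarrow> bd h E X \<noteq> {}"
  obtains J where "J \<subseteq> E" "\<forall>v\<in>V. odd (deg h J v)"
proof -
  define bad where "bad J = {v \<in> V. even (deg h J v)}" for J
  obtain J where J: "J \<subseteq> E" and least: "\<And>J'. J' \<subseteq> E \<Longrightarrow> card (bad J) \<le> card (bad J')"
    using ex_has_least_nat[of "\<lambda>J. J \<subseteq> E" "{}" "\<lambda>J. card (bad J)"] by auto
  have fJ: "finite J" using J assms(2) finite_subset by auto
  have "bad J = {}"
  proof (rule ccontr)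
    assume "bad J \<noteq> {}"
    then obtain v where v: "v \<in> V" "even (deg h J v)" unfolding bad_def by auto
    define K where "K = {w. (v, w) \<in> (adj h E)\<^sup>*}"
    have "w \<in> V" if "(v, w) \<in> (adj h E)\<^sup>*" for w
      using that by (induction rule: rtrancl_induct) (use v h in \<open>auto simp: adj_def\<close>)
    then have KV: "K \<subseteq> V" unfolding K_def by auto
    have fK: "finite K" using KV assms(1) finite_subset by auto
    have bK: "bd h E K = {}" unfolding K_def by (rule bd_reach_empty) (use h in auto)
    then have evK: "even (card K)" using cuts[OF KV] by auto
    have "bd h J K = {}" using bK J unfolding bd_def by auto
    then have 1: "even (card {x \<in> K. odd (deg h J x)})"
      using handshake[OF fJ fK, of h] h J by auto
    have "card K = card {x \<in> K. odd (deg h J x)} + card {x \<in> K. even (deg h J x)}"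
      using fK by (subst card_Un_disjoint[symmetric]) (auto intro: arg_cong[where f=card])
    with 1 evK have "even (card {x \<in> K. even (deg h J x)})" by auto
    moreover have vK: "v \<in> {x \<in> K. even (deg h J x)}" using v unfolding K_def by auto
    ultimately have "{x \<in> K. even (deg h J x)} \<noteq> {v}" by auto
    then obtain w where w: "w \<in> K" "even (deg h J w)" "w \<noteq> v" using vK by auto
    obtain P where P: "P \<subseteq> E" "finite P" "\<And>x. odd (deg h P x) \<longleftrightarrow> (x = v) \<noteq> (x = w)"
      using path_join[of v w h E] w h unfolding K_def by auto
    have eq: "even (deg h (sym_diff J P) x) \<longleftrightarrow> even (deg h J x) \<noteq> (x = v \<or> x = w)" for x
      using odd_deg_sym_diff[OF fJ P(2), of h x] P(3)[of x] w(3) by auto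
    have sub: "bad (sym_diff J P) \<subset> bad J"
      unfolding bad_def using w v KV by (auto simp: eq)
    have "card (bad (sym_diff J P)) < card (bad J)"
      by (rule psubset_card_mono[OF _ sub]) (use assms(1) in \<open>auto simp: bad_def\<close>)
    moreover have "card (bad J) \<le> card (bad (sym_diff J P))" using J P(1) by (intro least) auto
    ultimately show False by simp
  qed
  then show ?thesis using that[OF J] unfolding bad_def by blast
qed

section \<open>Antipodal metrics\<close>

text \<open>\<open>b\<close> plays the antipodal map. Distinct points may have distance 0, and
  antipodal distances are only bounded below; minimality will turn this bound into an
  equality.\<close>

definition antipodal_metric :: "nat \<Rightarrow> 'a set \<Rightarrow> ('a \<Rightarrow> 'a) \<Rightarrow> ('a \<Rightarrow> 'a \<Rightarrow> nat) \<Rightarrow> bool" where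
  "antipodal_metric r X b m \<longleftrightarrow>
    (\<forall>x\<in>X. m x x = 0 \<and> r \<le> m x (b x)) \<and>
    (\<forall>x\<in>X. \<forall>y\<in>X. m x y = m y x \<and> m (b x) (b y) = m x y) \<and>
    (\<forall>x\<in>X. \<forall>y\<in>X. \<forall>z\<in>X. m x z \<le> m x y + m y z)"

text \<open>A new edge of length \<open>l\<close> between \<open>x\<close> and \<open>y\<close> is
  added together with its antipodal copy, and \<open>n\<close> is the resulting shortest-path
  metric. The bound \<open>r \<le> l + m x (b y)\<close> keeps antipodal points far apart; the last
  two assumptions make it pointless to use two shortcuts on one path.\<close>

lemma shortcut:
  assumes b: "\<And>x. x \<in> X \<Longrightarrow> b x \<in> X \<and> b (b x) = x"
    and m: "antipodal_metric r X b m"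
    and par: "\<And>x y z. x \<in> X \<Longrightarrow> y \<in> X \<Longrightarrow> z \<in> X \<Longrightarrow> even (m x y + m y z + m x z)"
    and x: "x \<in> X" and y: "y \<in> X"
    and l: "l < m x y" "even (l + m x y)" "r \<le> l + m x (b y)"
    and xy: "m x (b x) \<le> 2 * l + m y (b y)" "m y (b y) \<le> 2 * l + m x (b x)"
  obtains n where "antipodal_metric r X b n"
    "\<And>u v. u \<in> X \<Longrightarrow> v \<in> X \<Longrightarrow> n u v \<le> m u v \<and> even (n u v + m u v)" "n x y < m x y"
proof -
  have m0: "m u u = 0" "r \<le> m u (b u)" if "u \<in> X" for u using m that unfolding antipodal_metric_def by auto
  have ms: "m u v = m v u" and mb: "m (b u) (b v) = m u v" if "u \<in> X" "v \<in> X" for u v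
    using m that unfolding antipodal_metric_def by auto
  have mt: "m u w \<le> m u v + m v w" if "u \<in> X" "v \<in> X" "w \<in> X" for u v w
    using m that unfolding antipodal_metric_def by auto
  \<comment> \<open>The shortcut and its antipodal copy, each in both directions.\<close>
  define Q where "Q = {(x, y), (y, x), (b x, b y), (b y, b x)}"
  define c where "c u v = (\<lambda>(p, q). m u p + l + m q v)" for u v
  define n where "n u v = Min (insert (m u v) (c u v ` Q))" for u v
  have Q: "p \<in> X" "q \<in> X" "(q, p) \<in> Q" "(b p, b q) \<in> Q" "m p q = m x y" "m p (b q) = m x (b y)"
      "m p (b p) \<le> 2 * l + m q (b q)" if "(p, q) \<in> Q" for p q
  proof -
    have bb: "m y (b x) = m x (b y)" "m (b x) y = m x (b y)" "m (b y) x = m x (b y)"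
      "m (b x) x = m x (b x)" "m (b y) y = m y (b y)" "m (b x) (b y) = m x y" "m (b y) (b x) = m x y" "m y x = m x y"
      using ms[of x y] ms[of "b y" x] ms[of y "b x"] ms[of "b x" x] ms[of "b y" y] ms[of "b x" "b y"]
        mb[of x y] mb[of "b x" y] b[OF x] b[OF y] x y by simp_all
    show "p \<in> X" "q \<in> X" "(q, p) \<in> Q" "(b p, b q) \<in> Q" "m p q = m x y" "m p (b q) = m x (b y)"
      "m p (b p) \<le> 2 * l + m q (b q)"
      using that b[OF x] b[OF y] x y xy bb unfolding Q_def by (elim insertE; simp)+
  qed
  \<comment> \<open>A path with two shortcuts either ends the second where the first one ended, or
    gains nothing over going from \<open>p\<close> to \<open>q'\<close> directly. Only the case
    \<open>q' = b p\<close> relies on the comparison of antipodal distances.\<close>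
  have QQ: "q' = q \<or> m p q' \<le> 2 * l + m q p'" if "(p, q) \<in> Q" "(p', q') \<in> Q" for p q p' q'
  proof -
    note 1 = Q[OF that(1)]
    have "(p', q') \<in> {(p, q), (q, p), (b p, b q), (b q, b p)}"
      using that b[OF x] b[OF y] unfolding Q_def by (elim insertE; simp)
    moreover have "m p (b q) = m q (b p)" using mb[of p "b q"] ms[of "b p" q] 1 b by auto
    moreover have "m p p = 0" using m0 1 by auto
    ultimately show ?thesis using 1 by (elim insertE) auto
  qed
  have nle: "n u v \<le> k \<longleftrightarrow> m u v \<le> k \<or> (\<exists>(p, q) \<in> Q. m u p + l + m q v \<le> k)" for u v k
    unfolding n_def c_def by (subst Min_le_iff) (auto simp: Q_def)
  have nin: "n u v = m u v \<or> (\<exists>(p, q) \<in> Q. n u v = m u p + l + m q v)" for u v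
  proof -
    have "n u v \<in> insert (m u v) (c u v ` Q)" unfolding n_def by (intro Min_in) (auto simp: Q_def)
    then show ?thesis unfolding c_def by auto
  qed
  have nm: "n u v \<le> m u v" for u v using nle by auto
  have nQ: "n u v \<le> m u p + l + m q v" if "(p, q) \<in> Q" for u v p q using nle that by blast
  have sym1: "n v u \<le> n u v" if uv: "u \<in> X" "v \<in> X" for u v
    using nin[of u v]
  proof
    assume "n u v = m u v" then show ?thesis using nm[of v u] ms uv by auto
  next
    assume "\<exists>(p, q) \<in> Q. n u v = m u p + l + m q v"
    then obtain p q where pq: "(p, q) \<in> Q" "n u v = m u p + l + m q v" by auto
    note 1 = Q[OF pq(1)]
    have "n v u \<le> m v q + l + m p u" using nQ[OF 1(3)] .
    then show ?thesis using pq(2) ms[of v q] ms[of p u] uv 1 by linarith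
  qed
  have bar1: "n (b u) (b v) \<le> n u v" if uv: "u \<in> X" "v \<in> X" for u v
    using nin[of u v]
  proof
    assume "n u v = m u v" then show ?thesis using nm[of "b u" "b v"] mb uv by auto
  next
    assume "\<exists>(p, q) \<in> Q. n u v = m u p + l + m q v"
    then obtain p q where pq: "(p, q) \<in> Q" "n u v = m u p + l + m q v" by auto
    note 1 = Q[OF pq(1)]
    have "n (b u) (b v) \<le> m (b u) (b p) + l + m (b q) (b v)" using nQ[OF 1(4)] .
    then show ?thesis using pq(2) mb uv 1 by simp
  qed
  have tri: "n u w \<le> n u v + n v w" if uvw: "u \<in> X" "v \<in> X" "w \<in> X" for u v w
  proof -
    consider "n u v = m u v" "n v w = m v w"
      | p q where "(p, q) \<in> Q" "n u v = m u p + l + m q v" "n v w = m v w"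
      | p q where "(p, q) \<in> Q" "n v w = m v p + l + m q w" "n u v = m u v"
      | p q p' q' where "(p, q) \<in> Q" "n u v = m u p + l + m q v" "(p', q') \<in> Q" "n v w = m v p' + l + m q' w"
      using nin[of u v] nin[of v w] by blast
    then show ?thesis
    proof cases
      case 1 then show ?thesis using nm[of u w] mt[OF uvw] by linarith
    next
      case (2 p q)
      note 1 = Q[OF 2(1)]
      show ?thesis using 2 nQ[OF 2(1), of u w] mt[of q v w] 1 uvw by linarith
    next
      case (3 p q)
      note 1 = Q[OF 3(1)]
      show ?thesis using 3 nQ[OF 3(1), of u w] mt[of u v p] 1 uvw by linarith
    next
      case (4 p q p' q')
      note 1 = Q[OF 4(1)] and 2 = Q[OF 4(3)]
      show ?thesis using QQ[OF 4(1,3)]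
      proof
        assume "q' = q" then show ?thesis using 4 nQ[OF 4(1), of u w] by simp
      next
        assume "m p q' \<le> 2 * l + m q p'"
        then show ?thesis using 4 nm[of u w] mt[of u p w] mt[of p q' w] mt[of q v p'] 1 2 uvw by linarith
      qed
    qed
  qed
  have bar: "r \<le> n u (b u)" if u: "u \<in> X" for u
    using nin[of u "b u"]
  proof
    assume "n u (b u) = m u (b u)" then show ?thesis using m0 u by auto
  next
    assume "\<exists>(p, q) \<in> Q. n u (b u) = m u p + l + m q (b u)"
    then obtain p q where pq: "(p, q) \<in> Q" "n u (b u) = m u p + l + m q (b u)" by auto
    note 1 = Q[OF pq(1)]
    \<comment> \<open>Antipodal symmetry turns the last leg into a path from \<open>u\<close> to
      \<open>b q\<close>, so both legs together have length at least
      \<open>m p (b q) = m x (b y)\<close>.\<close>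
    have "m q (b u) = m u (b q)" using mb[of q "b u"] ms[of "b q" u] b u 1 by auto
    moreover have "m p (b q) \<le> m p u + m u (b q)" using 1 u b by (intro mt) auto
    ultimately show ?thesis using pq 1 l ms[of p u] u by auto
  qed
  have parity: "even (n u v + m u v)" if uv: "u \<in> X" "v \<in> X" for u v
    using nin[of u v]
  proof
    assume "n u v = m u v" then show ?thesis by auto
  next
    assume "\<exists>(p, q) \<in> Q. n u v = m u p + l + m q v"
    then obtain p q where pq: "(p, q) \<in> Q" "n u v = m u p + l + m q v" by auto
    note 1 = Q[OF pq(1)]
    show ?thesis using pq 1 l par[of u p q] par[of u q v] uv by auto
  qed
  show ?thesis
  proof
    have eq: "n u v = n v u" "n (b u) (b v) = n u v" if "u \<in> X" "v \<in> X" for u v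
      using sym1[of u v] sym1[of v u] bar1[of u v] bar1[of "b u" "b v"] that b by (simp_all add: order_antisym)
    show "antipodal_metric r X b n" unfolding antipodal_metric_def
    proof (intro conjI ballI)
      fix u assume "u \<in> X" then show "n u u = 0" using nm[of u u] m0 by auto
    qed (use bar tri eq in auto)
    show "n u v \<le> m u v \<and> even (n u v + m u v)" if "u \<in> X" "v \<in> X" for u v
      using nm parity that by auto
    have "n x y \<le> m x x + l + m y y" by (rule nQ) (simp add: Q_def)
    then show "n x y < m x y" using m0 x y l by auto
  qed
qed

text \<open>Among the metrics below \<open>d\<close> with the same parities, one with the least sum
  is taken. By parity every failure of an equality is an excess of at least 2, so a distance could
  be cut by 2, decreasing the sum. Antipodal distances are treated before the rest, since
  \<open>shortcut\<close> compares those of the two ends.\<close>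

lemma tighten:
  assumes "finite X" and b: "\<And>x. x \<in> X \<Longrightarrow> b x \<in> X \<and> b (b x) = x"
    and d: "antipodal_metric r X b d" and r: "r \<ge> 2"
    and par: "\<And>x y z. x \<in> X \<Longrightarrow> y \<in> X \<Longrightarrow> z \<in> X \<Longrightarrow> even (d x y + d y z + d x z)"
    and parb: "\<And>x. x \<in> X \<Longrightarrow> even (d x (b x) + r)"
  obtains m where "antipodal_metric r X b m"
    "\<forall>u\<in>X. \<forall>v\<in>X. m u v \<le> d u v \<and> even (m u v + d u v)" "\<forall>u\<in>X. \<forall>v\<in>X. m u v + m u (b v) = r"
proof -
  define adm where "adm m \<longleftrightarrow> antipodal_metric r X b m \<and> (\<forall>u\<in>X. \<forall>v\<in>X. m u v \<le> d u v \<and> even (m u v + d u v))" for m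
  define S where "S m = (\<Sum>(u, v)\<in>X \<times> X. m u v :: nat)" for m
  have "adm d" unfolding adm_def using d by auto
  then obtain m where m: "adm m" and least: "\<And>n. adm n \<Longrightarrow> S m \<le> S n"
    using ex_has_least_nat[of adm d S] by auto
  have am: "antipodal_metric r X b m" and md: "\<And>u v. u \<in> X \<Longrightarrow> v \<in> X \<Longrightarrow> m u v \<le> d u v \<and> even (m u v + d u v)"
    using m unfolding adm_def by auto
  have parm: "even (m x y + m y z + m x z)" if "x \<in> X" "y \<in> X" "z \<in> X" for x y z
    using par[OF that] md[of x y] md[of y z] md[of x z] that by auto
  have parbm: "even (m x (b x) + r)" if "x \<in> X" for x
    using parb[OF that] md[of x "b x"] that b by auto
  have no_short: False
    if "x \<in> X" "y \<in> X" "l < m x y" "even (l + m x y)" "r \<le> l + m x (b y)"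
      "m x (b x) \<le> 2 * l + m y (b y)" "m y (b y) \<le> 2 * l + m x (b x)" for x y l
  proof -
    note prems = that
    obtain n where n: "antipodal_metric r X b n"
      "\<And>u v. u \<in> X \<Longrightarrow> v \<in> X \<Longrightarrow> n u v \<le> m u v \<and> even (n u v + m u v)" "n x y < m x y"
      by (rule shortcut[of X b r m x y l]) (use b am parm prems in blast)+
    have "n u v \<le> d u v \<and> even (n u v + d u v)" if "u \<in> X" "v \<in> X" for u v
    proof -
      have "n u v \<le> m u v" "m u v \<le> d u v" "even (n u v + m u v)" "even (m u v + d u v)"
        using n(2)[OF that] md[OF that] by auto
      then show ?thesis by (metis dual_order.trans even_add)
    qed
    then have "adm n" unfolding adm_def using n(1) by auto
    then have "S m \<le> S n" by (rule least)
    moreover have "S n < S m" unfolding S_def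
      by (rule sum_strict_mono_ex1) (use assms(1) n(2,3) that(1,2) in auto)
    ultimately show False by simp
  qed
  have mr: "m x (b x) = r" if x: "x \<in> X" for x
  proof (rule ccontr)
    assume ne: "m x (b x) \<noteq> r"
    have "r \<le> m x (b x)" using am x unfolding antipodal_metric_def by auto
    moreover have "m x (b x) \<noteq> r + 1" using parbm[OF x] by auto
    ultimately have ge: "m x (b x) \<ge> r + 2" using ne by linarith
    have eq: "m (b x) (b (b x)) = m x (b x)" and z: "m x (b (b x)) = 0"
      using am x b unfolding antipodal_metric_def by auto
    show False
      by (rule no_short[of x "b x" "m x (b x) - 2"]) (use x b eq z ge r in auto)
  qed
  have "m u v + m u (b v) = r" if u: "u \<in> X" and v: "v \<in> X" for u v
  proof (rule ccontr)
    assume ne: "m u v + m u (b v) \<noteq> r"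
    have "m u (b u) \<le> m u v + m v (b u)" using am u v b unfolding antipodal_metric_def by auto
    moreover have "m v (b u) = m u (b v)" using am u v b unfolding antipodal_metric_def by metis
    moreover have "even (m u v + m u (b v) + r)"
      using parm[of u v "b v"] parbm[OF v] u v b mr by (metis even_add)
    moreover from this have "m u v + m u (b v) \<noteq> r + 1" by (metis even_add odd_one)
    ultimately have ge: "m u v + m u (b v) \<ge> r + 2" using ne mr[OF u] by linarith
    \<comment> \<open>The sum is at least 4, so one of the two distances can be lowered by
      2.\<close>
    then consider "m u v \<ge> 2" | "m u (b v) \<ge> 2" using r by linarith
    then show False
    proof cases
      case 1
      show False by (rule no_short[of u v "m u v - 2"]) (use 1 u v b mr ge in auto)
    next
      case 2
      show False by (rule no_short[of u "b v" "m u (b v) - 2"]) (use 2 u v b mr mr[of "b v"] ge in auto)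
    qed
  qed
  then show ?thesis using am md by (intro that ballI) auto
qed

section \<open>Embedding 3-trees into a cube\<close>

lemma cube_extend:
  fixes r :: nat
  assumes ABC: "A \<subseteq> {..<r}" "B \<subseteq> {..<r}" "C \<subseteq> {..<r}"
    and d: "card (sym_diff A B) = ab" "card (sym_diff A C) = ac" "card (sym_diff B C) = bc"
    and even: "even (a + b + ab)" "even (a + c + ac)" "even (b + c + bc)"
    and tri: "a \<le> b + ab" "b \<le> a + ab" "ab \<le> a + b" "a \<le> c + ac" "c \<le> a + ac" "ac \<le> a + c"
      "b \<le> c + bc" "c \<le> b + bc" "bc \<le> b + c"
    and per: "a + b + ab \<le> 2 * r" "a + c + ac \<le> 2 * r" "b + c + bc \<le> 2 * r"
  obtains Z where "Z \<subseteq> {..<r}" "card (sym_diff Z A) = a" "card (sym_diff Z B) = b" "card (sym_diff Z C) = c"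
proof -
  \<comment> \<open>Coordinates are sorted by which of the three sets disagrees with the other two;
    in \<open>N0\<close> none does. The distances determine the sizes of \<open>NA\<close>,
    \<open>NB\<close>, \<open>NC\<close>, and \<open>r\<close> then gives that of
    \<open>N0\<close>.\<close>
  define N0 where "N0 = {i. i < r \<and> (i \<in> A \<longleftrightarrow> i \<in> B) \<and> (i \<in> B \<longleftrightarrow> i \<in> C)}"
  define NA where "NA = {i. i < r \<and> \<not> (i \<in> A \<longleftrightarrow> i \<in> B) \<and> (i \<in> B \<longleftrightarrow> i \<in> C)}"
  define NB where "NB = {i. i < r \<and> \<not> (i \<in> A \<longleftrightarrow> i \<in> B) \<and> (i \<in> A \<longleftrightarrow> i \<in> C)}"
  define NC where "NC = {i. i < r \<and> (i \<in> A \<longleftrightarrow> i \<in> B) \<and> \<not> (i \<in> B \<longleftrightarrow> i \<in> C)}"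
  note N = N0_def NA_def NB_def NC_def
  have fin: "finite N0" "finite NA" "finite NB" "finite NC" unfolding N by auto
  have dj: "N0 \<inter> NA = {}" "N0 \<inter> NB = {}" "N0 \<inter> NC = {}" "NA \<inter> NB = {}" "NA \<inter> NC = {}" "NB \<inter> NC = {}"
    unfolding N by auto
  have "sym_diff A B = NA \<union> NB" "sym_diff A C = NA \<union> NC" "sym_diff B C = NB \<union> NC"
    using ABC unfolding N by auto
  then have cd: "card NA + card NB = ab" "card NA + card NC = ac" "card NB + card NC = bc"
    using d dj fin by (simp_all add: card_Un_disjoint)
  have four: "card (P \<union> Q \<union> (R \<union> S)) = card P + card Q + card R + card S"
    if "P \<subseteq> N0" "Q \<subseteq> NA" "R \<subseteq> NB" "S \<subseteq> NC" for P Q R S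
  proof -
    have "finite P" "finite Q" "finite R" "finite S" using that fin finite_subset by metis+
    moreover have "P \<inter> Q = {}" "R \<inter> S = {}" "(P \<union> Q) \<inter> (R \<union> S) = {}" using that dj by blast+
    ultimately show ?thesis by (simp add: card_Un_disjoint)
  qed
  have "{..<r} = N0 \<union> NA \<union> (NB \<union> NC)" unfolding N by auto
  then have "card (N0 \<union> NA \<union> (NB \<union> NC)) = r" by (metis card_lessThan)
  then have cr: "card N0 + card NA + card NB + card NC = r"
    using four[OF order_refl order_refl order_refl order_refl] by simp
  txt \<open>\<open>s\<close> is the number of coordinates at which \<open>Z\<close> differs from the majority of \<open>A\<close>, \<open>B\<close>, \<open>C\<close>. It determines
    the numbers \<open>zA\<close>, \<open>zB\<close>, \<open>zC\<close>, \<open>z0\<close> of such coordinates in \<open>NA\<close>, \<open>NB\<close>, \<open>NC\<close>, \<open>N0\<close> and is subject only to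
    bounds of one parity.\<close>
  define n0 nA nB nC where "n0 = int (card N0)" "nA = int (card NA)" "nB = int (card NB)" "nC = int (card NC)"
  note n = n0_nA_nB_nC_def
  have cd': "nA + nB = int ab" "nA + nC = int ac" "nB + nC = int bc" "n0 + nA + nB + nC = int r"
    using cd cr unfolding n by linarith+
  have nn: "n0 \<ge> 0" "nA \<ge> 0" "nB \<ge> 0" "nC \<ge> 0" unfolding n by auto
  define U where "U = int a + int b + int c - nA - nB - nC"
  define s where "s = max (max (int a - nA) (int b - nB)) (max (int c - nC) (U - 2 * n0))"
  have pe: "even (int a - nA - (int b - nB))" "even (int a - nA - (int c - nC))" "even (int a - nA - U)"
  proof -
    have "even (int (a + b + ab))" "even (int (a + c + ac))" "even (int (b + c + bc))" using even by presburger+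
    then show "even (int a - nA - (int b - nB))" "even (int a - nA - (int c - nC))" "even (int a - nA - U)"
      unfolding U_def of_nat_add cd'[symmetric] by presburger+
  qed
  have s_cases: "s = int a - nA \<or> s = int b - nB \<or> s = int c - nC \<or> s = U - 2 * n0"
    unfolding s_def max_def by presburger
  then have es: "even (int a - nA - s)" using pe by presburger
  have lo: "int a - nA \<le> s" "int b - nB \<le> s" "int c - nC \<le> s" "U - 2 * n0 \<le> s" unfolding s_def by auto
  \<comment> \<open>Every lower bound in \<open>s\<close> is compared with every upper bound: a set
    against another set or against \<open>U\<close> gives a triangle inequality,
    \<open>U - 2 * n0\<close> against a set gives a perimeter bound, and the rest is nonnegativity
    of sizes.\<close>
  have hi: "s \<le> int a + nA" "s \<le> int b + nB" "s \<le> int c + nC" "s \<le> U"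
    using s_cases tri per nn cd' unfolding U_def by linarith+
  \<comment> \<open>On \<open>NA\<close> the majority differs from \<open>A\<close>, so the distance
    from \<open>Z\<close> to \<open>A\<close> is \<open>s + nA - 2 * zA\<close>; setting it to
    \<open>a\<close> gives \<open>zA\<close>, and \<open>z0\<close> is what remains of
    \<open>s\<close>.\<close>
  define zA zB zC z0 where
    "zA = nat ((s + nA - int a) div 2)" "zB = nat ((s + nB - int b) div 2)" "zC = nat ((s + nC - int c) div 2)"
    "z0 = nat ((U - s) div 2)"
  note z = zA_zB_zC_z0_def
  have ev: "even (s + nA - int a)" "even (s + nB - int b)" "even (s + nC - int c)" "even (U - s)"
    using es pe by presburger+
  have zz: "2 * int zA = s + nA - int a" "2 * int zB = s + nB - int b" "2 * int zC = s + nC - int c"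
    "2 * int z0 = U - s"
    using ev lo hi unfolding z by auto
  have le: "zA \<le> card NA" "zB \<le> card NB" "zC \<le> card NC" "z0 \<le> card N0"
    using zz lo hi unfolding n by linarith+
  obtain SA where SA: "SA \<subseteq> NA" "card SA = zA" using le(1) by (meson obtain_subset_with_card_n)
  obtain SB where SB: "SB \<subseteq> NB" "card SB = zB" using le(2) by (meson obtain_subset_with_card_n)
  obtain SC where SC: "SC \<subseteq> NC" "card SC = zC" using le(3) by (meson obtain_subset_with_card_n)
  obtain S0 where S0: "S0 \<subseteq> N0" "card S0 = z0" using le(4) by (meson obtain_subset_with_card_n)
  note finS = finite_subset[OF SA(1) fin(2)] finite_subset[OF SB(1) fin(3)] finite_subset[OF SC(1) fin(4)]
    finite_subset[OF S0(1) fin(1)]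
  define M where "M i \<longleftrightarrow> (i \<in> A \<and> i \<in> B) \<or> (i \<in> A \<and> i \<in> C) \<or> (i \<in> B \<and> i \<in> C)" for i
  define Z where "Z = {i. i < r \<and> (M i \<longleftrightarrow> i \<notin> S0 \<union> SA \<union> SB \<union> SC)}"
  have Sin: "i \<in> S0 \<Longrightarrow> i \<in> N0" "i \<in> SA \<Longrightarrow> i \<in> NA" "i \<in> SB \<Longrightarrow> i \<in> NB" "i \<in> SC \<Longrightarrow> i \<in> NC" for i
    using S0 SA SB SC by auto
  have eqA: "sym_diff Z A = S0 \<union> (NA - SA) \<union> (SB \<union> SC)"
  proof (rule set_eqI)
    fix i show "i \<in> sym_diff Z A \<longleftrightarrow> i \<in> S0 \<union> (NA - SA) \<union> (SB \<union> SC)"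
      using ABC Sin[of i] unfolding Z_def M_def N
      by (cases "i < r"; cases "i \<in> A"; cases "i \<in> B"; cases "i \<in> C") (auto simp: subset_iff)
  qed
  have eqB: "sym_diff Z B = S0 \<union> SA \<union> ((NB - SB) \<union> SC)"
  proof (rule set_eqI)
    fix i show "i \<in> sym_diff Z B \<longleftrightarrow> i \<in> S0 \<union> SA \<union> ((NB - SB) \<union> SC)"
      using ABC Sin[of i] unfolding Z_def M_def N
      by (cases "i < r"; cases "i \<in> A"; cases "i \<in> B"; cases "i \<in> C") (auto simp: subset_iff)
  qed
  have eqC: "sym_diff Z C = S0 \<union> SA \<union> (SB \<union> (NC - SC))"
  proof (rule set_eqI)
    fix i show "i \<in> sym_diff Z C \<longleftrightarrow> i \<in> S0 \<union> SA \<union> (SB \<union> (NC - SC))"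
      using ABC Sin[of i] unfolding Z_def M_def N
      by (cases "i < r"; cases "i \<in> A"; cases "i \<in> B"; cases "i \<in> C") (auto simp: subset_iff)
  qed
  have "card (sym_diff Z A) = z0 + (card NA - zA) + zB + zC"
    unfolding eqA by (subst four) (use S0 SA SB SC finS in \<open>auto simp: card_Diff_subset\<close>)
  then have "2 * int (card (sym_diff Z A)) = 2 * int a"
    using zz le(1) unfolding U_def n by linarith
  moreover have "card (sym_diff Z B) = z0 + zA + (card NB - zB) + zC"
    unfolding eqB by (subst four) (use S0 SA SB SC finS in \<open>auto simp: card_Diff_subset\<close>)
  then have "2 * int (card (sym_diff Z B)) = 2 * int b"
    using zz le(2) unfolding U_def n by linarith
  moreover have "card (sym_diff Z C) = z0 + zA + zB + (card NC - zC)"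
    unfolding eqC by (subst four) (use S0 SA SB SC finS in \<open>auto simp: card_Diff_subset\<close>)
  then have "2 * int (card (sym_diff Z C)) = 2 * int c"
    using zz le(3) unfolding U_def n by linarith
  moreover have "Z \<subseteq> {..<r}" unfolding Z_def by auto
  ultimately show ?thesis using that by simp
qed

lemma three_tree_props:
  assumes "three_tree W D"
  shows "finite W \<and> (\<forall>u v. {u, v} \<in> D \<longrightarrow> u \<in> W \<and> v \<in> W \<and> u \<noteq> v)"
  using assms
proof induction
  case (K4 W)
  then have "finite W" using card.infinite by fastforce
  then show ?case by (auto simp: doubleton_eq_iff)
next
  case (add_vertex W D x T)
  then show ?case by (auto simp: doubleton_eq_iff)
qed

text \<open>These are the conditions on triples under which \<open>cube_extend\<close> applies. They
  are imposed on the whole type, so that the induction over the 3-tree carries no membership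
  conditions; the weights will be pulled back along a map into the faces.\<close>

definition cube_weights :: "nat \<Rightarrow> ('a \<Rightarrow> 'a \<Rightarrow> nat) \<Rightarrow> bool" where
  "cube_weights r p \<longleftrightarrow> (\<forall>x. p x x = 0) \<and> (\<forall>x y. p x y = p y x) \<and>
    (\<forall>x y z. p x z \<le> p x y + p y z \<and> even (p x y + p y z + p x z) \<and> p x y + p y z + p x z \<le> 2 * r)"

lemma cube_weightsD:
  assumes "cube_weights r p"
  shows "p x x = 0" "p x y = p y x" "p x z \<le> p x y + p y z" "even (p x y + p y z + p x z)"
    "p x y + p y z + p x z \<le> 2 * r"
proof -
  note 0 = assms[unfolded cube_weights_def]
  note 1 = 0[THEN conjunct1] 0[THEN conjunct2, THEN conjunct1] 0[THEN conjunct2, THEN conjunct2]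
  show "p x x = 0" "p x y = p y x" using 1(1)[rule_format, of x] 1(2)[rule_format, of x y] by (simp_all only:)
  show "p x z \<le> p x y + p y z" "even (p x y + p y z + p x z)" "p x y + p y z + p x z \<le> 2 * r"
    using 1(3)[rule_format, of x z y] by (simp_all only:)
qed

lemma cube_extend_weights:
  assumes p: "cube_weights r p"
    and "A \<subseteq> {..<r}" "B \<subseteq> {..<r}" "C \<subseteq> {..<r}"
    and "card (sym_diff A B) = p x y" "card (sym_diff A C) = p x z" "card (sym_diff B C) = p y z"
  obtains Z where "Z \<subseteq> {..<r}" "card (sym_diff Z A) = p w x" "card (sym_diff Z B) = p w y" "card (sym_diff Z C) = p w z"
proof -
  note s = cube_weightsD(2)[OF p] and t = cube_weightsD(3-5)[OF p]
  have three: "even (p w u + p w v + p u v)" "p w u \<le> p w v + p u v" "p w v \<le> p w u + p u v"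
    "p u v \<le> p w u + p w v" "p w u + p w v + p u v \<le> 2 * r" for u v
  proof -
    have "even (p u w + p w v + p u v)" by (rule t)
    then show "even (p w u + p w v + p u v)" by (simp only: s[of u w])
    show "p w u \<le> p w v + p u v" "p w v \<le> p w u + p u v" "p u v \<le> p w u + p w v" "p w u + p w v + p u v \<le> 2 * r"
      using t(3)[of u w v] t(1)[of w u v] t(1)[of w v u] t(1)[of u v w] s[of u w] s[of u v] by linarith+
  qed
  show thesis
    by (rule cube_extend[OF assms(2-7) three(1) three(1) three(1) three(2-4) three(2-4) three(2-4)
          three(5) three(5) three(5)]) (rule that)
qed

text \<open>A new vertex must be at the right distance from the vertices of a triangle only, and
  these are mutually adjacent, hence already placed as the extension step requires. Distances
  between non-adjacent vertices are left open.\<close>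

lemma three_tree_cube_embedding:
  assumes "three_tree W D" and p: "cube_weights r p"
  shows "\<exists>\<phi>. (\<forall>x\<in>W. \<phi> x \<subseteq> {..<r}) \<and> (\<forall>x y. {x, y} \<in> D \<longrightarrow> card (sym_diff (\<phi> x) (\<phi> y)) = p x y)"
  using assms(1)
proof induction
  case (K4 W)
  note z = cube_weightsD(1)[OF p] and s = cube_weightsD(2)[OF p]
  obtain a W' where a: "W = insert a W'" "a \<notin> W'" "card W' = 3"
    using K4 card_Suc_eq[of W 3] by auto
  then obtain b c d where "W' = {b, c, d}" "distinct [b, c, d]" by (auto simp: card_3_iff)
  with a have W: "W = {a, b, c, d}" "distinct [a, b, c, d]" by auto
  \<comment> \<open>The first vertex goes to the empty set; repeating points in the three-point
    extension step then places the next two.\<close>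
  have E: "({}::nat set) \<subseteq> {..<r}" "card (sym_diff {} ({}::nat set)) = p a a" using z by auto
  obtain B where B: "B \<subseteq> {..<r}" "card (sym_diff B {}) = p b a"
    using cube_extend_weights[OF p E(1) E(1) E(1) E(2) E(2) E(2), of b] by blast
  have B': "card (sym_diff {} B) = p a b" "card (sym_diff B B) = p b b"
    using B(2) z[of b] s[of a b] by (simp_all add: Un_commute)
  obtain C where C: "C \<subseteq> {..<r}" "card (sym_diff C {}) = p c a" "card (sym_diff C B) = p c b"
    using cube_extend_weights[OF p E(1) B(1) B(1) B'(1) B'(1) B'(2), of c] by blast
  have C': "card (sym_diff {} C) = p a c" "card (sym_diff B C) = p b c"
    using C(2,3) s[of a c] s[of b c] by (simp_all add: Un_commute)
  obtain D where D: "D \<subseteq> {..<r}" "card (sym_diff D {}) = p d a" "card (sym_diff D B) = p d b" "card (sym_diff D C) = p d c"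
    using cube_extend_weights[OF p E(1) B(1) C(1) B'(1) C', of d] by blast
  have D': "card (sym_diff {} D) = p a d" "card (sym_diff B D) = p b d" "card (sym_diff C D) = p c d"
    using D(2-4) s[of a d] s[of b d] s[of c d] by (simp_all add: Un_commute)
  define \<phi> where "\<phi> = (\<lambda>x. if x = b then B else if x = c then C else if x = d then D else {})"
  have \<phi>p: "card (sym_diff (\<phi> x) (\<phi> y)) = p x y" if "x \<in> W" "y \<in> W" "x \<noteq> y" for x y
  proof -
    define P where "P x y \<longleftrightarrow> card (sym_diff (\<phi> x) (\<phi> y)) = p x y" for x y
    have v: "\<phi> a = {}" "\<phi> b = B" "\<phi> c = C" "\<phi> d = D" using W(2) unfolding \<phi>_def by auto
    have six: "P a b" "P a c" "P a d" "P b c" "P b d" "P c d"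
      unfolding P_def v by (fact B' C' D')+
    have "P y x" if "P x y" for x y
      using that s[of x y] unfolding P_def by (simp only: Un_commute)
    then have "P x y" using W(1) \<open>x \<in> W\<close> \<open>y \<in> W\<close> \<open>x \<noteq> y\<close> six by blast
    then show ?thesis unfolding P_def .
  qed
  have \<phi>r: "\<phi> x \<subseteq> {..<r}" for x using B(1) C(1) D(1) unfolding \<phi>_def by simp
  show ?case
  proof (intro exI[of _ \<phi>] conjI ballI allI impI \<phi>r)
    fix x y assume "{x, y} \<in> {{u, v} |u v. u \<in> W \<and> v \<in> W \<and> u \<noteq> v}"
    then have "x \<in> W" "y \<in> W" "x \<noteq> y" by (auto simp: doubleton_eq_iff)
    then show "card (sym_diff (\<phi> x) (\<phi> y)) = p x y" by (rule \<phi>p)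
  qed
next
  case (add_vertex W D x T)
  obtain \<phi> where IH: "\<forall>x\<in>W. \<phi> x \<subseteq> {..<r}"
    "\<forall>x y. {x, y} \<in> D \<longrightarrow> card (sym_diff (\<phi> x) (\<phi> y)) = p x y" using add_vertex.IH by (elim exE conjE)
  note \<phi> = IH(1)[rule_format] IH(2)[rule_format]
  obtain a b c where T: "T = {a, b, c}" "distinct [a, b, c]"
    using add_vertex.hyps(4) unfolding card_3_iff by auto
  have D: "{a, b} \<in> D" "{a, c} \<in> D" "{b, c} \<in> D" using add_vertex.hyps(5) T by auto
  note s = cube_weightsD(2)[OF p]
  have W: "a \<in> W" "b \<in> W" "c \<in> W" using add_vertex.hyps(3) T by auto
  obtain Z where Z: "Z \<subseteq> {..<r}" "card (sym_diff Z (\<phi> a)) = p x a" "card (sym_diff Z (\<phi> b)) = p x b"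
    "card (sym_diff Z (\<phi> c)) = p x c"
    using cube_extend_weights[OF p \<phi>(1)[OF W(1)] \<phi>(1)[OF W(2)] \<phi>(1)[OF W(3)]
        \<phi>(2)[OF D(1)] \<phi>(2)[OF D(2)] \<phi>(2)[OF D(3)], of x] by blast
  have pr: "\<And>u v. {u, v} \<in> D \<Longrightarrow> u \<in> W \<and> v \<in> W" 
    using three_tree_props[OF add_vertex.hyps(1)] by simp
  have new: "card (sym_diff Z (\<phi> t)) = p x t" if "t \<in> T" for t
    using that Z(2-4) unfolding T(1) by (elim insertE) simp_all
  have xT: "x \<notin> T" using add_vertex.hyps by auto
  show ?case
  proof (intro exI[of _ "\<phi>(x := Z)"] conjI ballI allI impI)
    fix u assume "u \<in> insert x W" then show "(\<phi>(x := Z)) u \<subseteq> {..<r}" using Z \<phi> by auto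
  next
    fix u v assume "{u, v} \<in> D \<union> {{x, t} |t. t \<in> T}"
    then consider "{u, v} \<in> D" | "u = x" "v \<in> T" | "v = x" "u \<in> T" by (auto simp: doubleton_eq_iff)
    then show "card (sym_diff ((\<phi>(x := Z)) u) ((\<phi>(x := Z)) v)) = p u v"
    proof cases
      case 1
      then have "u \<noteq> x" "v \<noteq> x" using pr add_vertex.hyps(2) by auto
      then show ?thesis using \<phi>(2)[OF 1] by simp
    next
      case 2
      then have "v \<noteq> x" using xT by auto
      then show ?thesis using 2 new by simp
    next
      case 3
      then have "u \<noteq> x" using xT by auto
      then show ?thesis using 3 new[of u] s[of u x] by (simp add: Un_commute)
    qed
  qed
qed

section \<open>Colouring from an abstract dual\<close>

text \<open>This is all that the colouring uses of planarity: even subgraphs are dual cuts, and the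
  dual is connected. Dual edges have two distinct ends, which reflects the absence of bridges; the
  graph itself may be disconnected.\<close>

locale dual_multigraphs =
  fixes V :: "'v set" and E :: "'e set" and h :: "'e \<Rightarrow> 'v set" and F :: "'f set" and k :: "'e \<Rightarrow> 'f set"
  assumes finV: "finite V" and finE: "finite E" and finF: "finite F"
    and h: "e \<in> E \<Longrightarrow> h e \<subseteq> V" "e \<in> E \<Longrightarrow> card (h e) = 2"
    and k: "e \<in> E \<Longrightarrow> k e \<subseteq> F" "e \<in> E \<Longrightarrow> card (k e) = 2"
    and cycles_are_dual_cuts: "Z \<subseteq> E \<Longrightarrow> (\<forall>v\<in>V. even (deg h Z v)) \<longleftrightarrow> (\<exists>S\<subseteq>F. Z = bd k E S)"
    and dual_connected: "S \<subseteq> F \<Longrightarrow> bd k E S = {} \<Longrightarrow> S = {} \<or> S = F"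
begin

lemma fin: "Z \<subseteq> E \<Longrightarrow> finite Z"
  using finE finite_subset by auto

text \<open>By handshaking in the dual, \<open>Q\<close> meets every even subgraph in an even number
  of edges. So the parity of \<open>Q\<close> along a path depends only on its ends, and
  \<open>X\<close> collects the vertices at which this parity, counted from a root of the component,
  is odd.\<close>

lemma dual_even_is_cut:
  assumes Q: "Q \<subseteq> E" "\<And>H. H \<in> F \<Longrightarrow> even (deg k Q H)"
  obtains X where "X \<subseteq> V" "Q = bd h E X"
proof -
  have orth: "even (card (Z \<inter> Q))" if Z: "Z \<subseteq> E" "\<And>v. v \<in> V \<Longrightarrow> even (deg h Z v)" for Z
  proof -
    obtain S where S: "S \<subseteq> F" "Z = bd k E S" using cycles_are_dual_cuts[OF Z(1)] Z(2) by auto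
    have 1: "Z \<inter> Q = bd k Q S" unfolding S(2) by (rule bd_Int[OF Q(1)])
    have 2: "odd (card (bd k Q S)) \<longleftrightarrow> odd (card {x \<in> S. odd (deg k Q x)})"
      by (rule handshake[OF fin[OF Q(1)] finite_subset[OF S(1) finF] k(2)]) (use Q(1) in auto)
    have 3: "{x \<in> S. odd (deg k Q x)} = {}" using Q(2) S(1) by blast
    show ?thesis using 2 unfolding 1 3 by simp
  qed
  \<comment> \<open>The choice depends only on the set of reachable vertices, so a component has a
    single root.\<close>
  define root where "root x = (SOME y. (x, y) \<in> (adj h E)\<^sup>*)" for x
  have root: "(x, root x) \<in> (adj h E)\<^sup>*" for x unfolding root_def by (rule someI[of _ x]) simp
  have "\<exists>P. P \<subseteq> E \<and> finite P \<and> (\<forall>y. odd (deg h P y) \<longleftrightarrow> (y = x) \<noteq> (y = root x))" for x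
    by (rule path_join[OF root]) (rule h(2))
  then obtain P where P: "\<And>x. P x \<subseteq> E" "\<And>x. finite (P x)"
    "\<And>x y. odd (deg h (P x) y) \<longleftrightarrow> (y = x) \<noteq> (y = root x)" by metis
  define X where "X = {x \<in> V. odd (card (P x \<inter> Q))}"
  have "e \<in> Q \<longleftrightarrow> card (h e \<inter> X) = 1" if e: "e \<in> E" for e
  proof -
    obtain x y where xy: "h e = {x, y}" "x \<noteq> y" using h(2)[OF e] by (meson card_2_iff)
    have V: "x \<in> V" "y \<in> V" using h(1)[OF e] xy by auto
    have a: "(x, y) \<in> adj h E" "(y, x) \<in> adj h E" using e xy unfolding adj_def by auto
    have "(x, z) \<in> (adj h E)\<^sup>* \<longleftrightarrow> (y, z) \<in> (adj h E)\<^sup>*" for z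
      using a converse_rtrancl_into_rtrancl[of x y "adj h E" z] converse_rtrancl_into_rtrancl[of y x "adj h E" z] by blast
    then have r: "root x = root y" unfolding root_def by simp
    have f: "finite (sym_diff (P x) (P y))" using P(2) by simp
    have "even (deg h (sym_diff (sym_diff (P x) (P y)) {e}) v)" for v
    proof -
      have "v \<in> h e \<longleftrightarrow> (v = x) \<noteq> (v = y)" using xy by auto
      moreover have "odd (deg h (sym_diff (P x) (P y)) v) \<longleftrightarrow> (v = x) \<noteq> (v = y)"
        unfolding odd_deg_sym_diff[OF P(2) P(2)] P(3) r by blast
      ultimately show ?thesis using odd_deg_sym_diff[OF f, of "{e}" h v] odd_deg_singleton[of h e v] by simp
    qed
    then have "even (card (sym_diff (sym_diff (P x) (P y)) {e} \<inter> Q))"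
      using P(1)[of x] P(1)[of y] e by (intro orth) auto
    then have "odd (card ({e} \<inter> Q)) \<longleftrightarrow> odd (card (P x \<inter> Q)) \<noteq> odd (card (P y \<inter> Q))"
      using odd_card_Int_sym_diff[OF f, of "{e}" Q] odd_card_Int_sym_diff[OF P(2) P(2), of x y Q] by blast
    moreover have "odd (card ({e} \<inter> Q)) \<longleftrightarrow> e \<in> Q" by (cases "e \<in> Q") auto
    moreover have "x \<in> X \<longleftrightarrow> odd (card (P x \<inter> Q))" "y \<in> X \<longleftrightarrow> odd (card (P y \<inter> Q))"
      using V unfolding X_def by simp_all
    ultimately show ?thesis unfolding xy card_2_Int_eq_1[OF xy(2)] by blast
  qed
  then have "Q = bd h E X" unfolding bd_def using Q(1) by blast
  moreover have "X \<subseteq> V" unfolding X_def by blast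
  ultimately show ?thesis using that by blast
qed

text \<open>The edges around \<open>H\<close> form the dual cut of \<open>{H}\<close>, an even
  subgraph, and the degree of \<open>H\<close> counts those of them with one end in
  \<open>X\<close>.\<close>

lemma cut_dual_even:
  assumes "X \<subseteq> V" "H \<in> F"
  shows "even (deg k (bd h E X) H)"
proof -
  define Z where "Z = bd k E {H}"
  have ZE: "Z \<subseteq> E" unfolding Z_def bd_def by auto
  have ev: "\<forall>v\<in>V. even (deg h Z v)" using cycles_are_dual_cuts[OF ZE] assms(2) unfolding Z_def by auto
  have "card (k e \<inter> {H}) = 1 \<longleftrightarrow> H \<in> k e" for e by (cases "H \<in> k e") auto
  then have "{e \<in> bd h E X. H \<in> k e} = bd h E X \<inter> Z" unfolding Z_def bd_def by auto
  also have "\<dots> = bd h Z X" by (rule bd_Int[OF ZE])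
  finally have "deg k (bd h E X) H = card (bd h Z X)" unfolding deg_def by simp
  moreover have "odd (card (bd h Z X)) \<longleftrightarrow> odd (card {x \<in> X. odd (deg h Z x)})"
    by (rule handshake[OF fin[OF ZE] finite_subset[OF assms(1) finV] h(2)]) (use ZE in auto)
  moreover have "{x \<in> X. odd (deg h Z x)} = {}" using ev assms(1) by blast
  ultimately show ?thesis by simp
qed

lemma dual_reach:
  assumes "H \<in> F" "H' \<in> F"
  shows "(H, H') \<in> (adj k E)\<^sup>*"
proof -
  define S where "S = {K. (H, K) \<in> (adj k E)\<^sup>*}"
  have "K \<in> F" if "(H, K) \<in> (adj k E)\<^sup>*" for K
    using that by (induction rule: rtrancl_induct) (use assms k in \<open>auto simp: adj_def\<close>)
  then have "S \<subseteq> F" unfolding S_def by auto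
  moreover have "bd k E S = {}" unfolding S_def by (rule bd_reach_empty) (use k in auto)
  moreover have "H \<in> S" unfolding S_def by auto
  ultimately have "S = F" using dual_connected by auto
  then show ?thesis using assms unfolding S_def by auto
qed

text \<open>A \<open>V\<close>-join \<open>J\<close> of the primal serves as the signature of the dual. The points \<open>(H, s)\<close> of the
  metric are the vertices of the signed double cover of the dual.\<close>

definition dual_join :: "'e set \<Rightarrow> 'f \<times> bool \<Rightarrow> 'f \<times> bool \<Rightarrow> 'e set \<Rightarrow> bool" where
  "dual_join J x y Q \<longleftrightarrow> Q \<subseteq> E \<and> (\<forall>H\<in>F. odd (deg k Q H) \<longleftrightarrow> (H = fst x) \<noteq> (H = fst y)) \<and>
     (odd (card (Q \<inter> J)) \<longleftrightarrow> snd x \<noteq> snd y)"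

text \<open>A join may consist of a path and cycles apart from it, so this can be less than the
  distance in the double cover. What matters survives: joins add up by symmetric difference, and one
  that closes up with a change of sign is an odd cut.\<close>

definition dual_dist :: "'e set \<Rightarrow> 'f \<times> bool \<Rightarrow> 'f \<times> bool \<Rightarrow> nat" where
  "dual_dist J x y = (LEAST n. \<exists>Q. dual_join J x y Q \<and> card Q = n)"

lemma dual_join_sym_diff:
  assumes "dual_join J x y Q" "dual_join J y z Q'"
  shows "dual_join J x z (sym_diff Q Q')"
proof -
  have f: "finite Q" "finite Q'" using assms fin unfolding dual_join_def by auto
  show ?thesis using assms unfolding dual_join_def odd_deg_sym_diff[OF f] odd_card_Int_sym_diff[OF f] by auto
qed

lemma dual_dist_le: "dual_join J x y Q \<Longrightarrow> dual_dist J x y \<le> card Q"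
  unfolding dual_dist_def by (rule Least_le) auto

end

section \<open>The signed dual metric and the colouring\<close>

locale odd_cut_bounded = dual_multigraphs +
  fixes r :: nat and J :: "'b set"
  assumes r2: "r \<ge> 2" and regular: "v \<in> V \<Longrightarrow> deg h E v = r"
    and cuts: "X \<subseteq> V \<Longrightarrow> odd (card X) \<Longrightarrow> r \<le> card (bd h E X)"
    and JE: "J \<subseteq> E" and J: "v \<in> V \<Longrightarrow> odd (deg h J v)"
    and Vne: "V \<noteq> {}"
begin

lemma card_cut_J:
  assumes "X \<subseteq> V"
  shows "odd (card (bd h E X \<inter> J)) \<longleftrightarrow> odd (card X)"
proof -
  have "odd (card (bd h J X)) \<longleftrightarrow> odd (card {x \<in> X. odd (deg h J x)})"
    by (rule handshake[OF fin[OF JE] finite_subset[OF assms finV] h(2)]) (use JE in auto)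
  moreover have "{x \<in> X. odd (deg h J x)} = X" using J assms by blast
  ultimately show ?thesis unfolding bd_Int[OF JE] by simp
qed

text \<open>Together with \<open>card_cut_J\<close> this fixes the parity of closed dual joins: one
  that keeps the sign has even size, one that changes it has the parity of \<open>r\<close>.\<close>

lemma card_cut_parity:
  assumes "X \<subseteq> V"
  shows "even (card (bd h E X) + r * card X)"
proof -
  have "odd (card (bd h E X)) \<longleftrightarrow> odd (card {x \<in> X. odd (deg h E x)})"
    by (rule handshake[OF finE finite_subset[OF assms finV] h(2)])
  moreover have "{x \<in> X. odd (deg h E x)} = (if odd r then X else {})" using regular assms by auto
  ultimately show ?thesis by (cases "even r") auto
qed

lemma dual_join_exists:
  assumes "fst x \<in> F" "fst y \<in> F"
  shows "\<exists>Q. dual_join J x y Q"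
proof -
  obtain P where P: "P \<subseteq> E" "finite P" "\<And>H. odd (deg k P H) \<longleftrightarrow> (H = fst x) \<noteq> (H = fst y)"
    using path_join[OF dual_reach[OF assms]] k by auto
  \<comment> \<open>The edges around one vertex form a closed dual join of negative sign; adding it
    corrects a wrong sign.\<close>
  obtain v where v: "v \<in> V" using Vne by auto
  define C where "C = bd h E {v}"
  have C: "C \<subseteq> E" "\<And>H. H \<in> F \<Longrightarrow> even (deg k C H)" "odd (card (C \<inter> J))"
    using cut_dual_even[of "{v}"] card_cut_J[of "{v}"] v unfolding C_def by (auto simp: bd_def)
  have "dual_join J x y P \<or> dual_join J x y (sym_diff P C)"
    unfolding dual_join_def odd_deg_sym_diff[OF P(2) fin[OF C(1)]] odd_card_Int_sym_diff[OF P(2) fin[OF C(1)]]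
    using P C by auto
  then show ?thesis by auto
qed

lemma dual_dist_attained:
  assumes "x \<in> F \<times> UNIV" "y \<in> F \<times> UNIV"
  obtains Q where "dual_join J x y Q" "card Q = dual_dist J x y"
proof -
  have "\<exists>n Q. dual_join J x y Q \<and> card Q = n" using dual_join_exists[of x y] assms by auto
  from LeastI_ex[OF this] show ?thesis using that unfolding dual_dist_def by auto
qed

text \<open>Here information returns from the dual to the graph: a join between copies of one face
  has even degree everywhere, so it is a cut, and its sign tells the parity of the side.\<close>

lemma dual_join_loop:
  assumes "dual_join J x y Q" "x \<in> F \<times> UNIV" "fst y = fst x"
  obtains X where "X \<subseteq> V" "Q = bd h E X" "odd (card X) \<longleftrightarrow> snd x \<noteq> snd y" "even (card Q + r * card X)"
proof -
  have Q: "Q \<subseteq> E" "\<And>H. H \<in> F \<Longrightarrow> even (deg k Q H)" "odd (card (Q \<inter> J)) \<longleftrightarrow> snd x \<noteq> snd y"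
    using assms unfolding dual_join_def by auto
  obtain X where X: "X \<subseteq> V" "Q = bd h E X" using dual_even_is_cut[OF Q(1,2)] by auto
  show ?thesis using that[OF X] card_cut_J[OF X(1)] card_cut_parity[OF X(1)] Q(3) X(2) by auto
qed

definition bar :: "'c \<times> bool \<Rightarrow> 'c \<times> bool" where "bar x = (fst x, \<not> snd x)"

lemma bar_in: "x \<in> F \<times> UNIV \<Longrightarrow> bar x \<in> F \<times> UNIV"
  unfolding bar_def by auto

lemma bar_simps: "fst (bar x) = fst x" "snd (bar x) \<longleftrightarrow> \<not> snd x"
  unfolding bar_def by auto

lemma dual_join_bar: "dual_join J (bar x) (bar y) Q \<longleftrightarrow> dual_join J x y Q"
  unfolding dual_join_def bar_def by auto

lemma dual_join_commute: "dual_join J y x Q \<longleftrightarrow> dual_join J x y Q"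
  unfolding dual_join_def by auto

lemma dual_dist_metric: "antipodal_metric r (F \<times> UNIV) bar (dual_dist J)"
  unfolding antipodal_metric_def
proof (intro conjI ballI)
  fix x :: "'c \<times> bool" assume x: "x \<in> F \<times> UNIV"
  have "dual_join J x x {}" unfolding dual_join_def by auto
  then show "dual_dist J x x = 0" using dual_dist_le by fastforce
  obtain Q where Q: "dual_join J x (bar x) Q" "card Q = dual_dist J x (bar x)"
    using dual_dist_attained[OF x bar_in[OF x]] by blast
  obtain X where X: "X \<subseteq> V" "Q = bd h E X" "odd (card X) \<longleftrightarrow> snd x \<noteq> snd (bar x)" "even (card Q + r * card X)"
    by (rule dual_join_loop[OF Q(1) x bar_simps(1)])
  have "odd (card X)" using X(3) bar_simps(2)[of x] by simp
  then show "r \<le> dual_dist J x (bar x)" using cuts[OF X(1)] X(2) Q(2) by simp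
next
  fix x y :: "'c \<times> bool"
  show "dual_dist J x y = dual_dist J y x" "dual_dist J (bar x) (bar y) = dual_dist J x y"
    unfolding dual_dist_def dual_join_bar dual_join_commute[of x y] by auto
next
  fix x y z :: "'c \<times> bool" assume xyz: "x \<in> F \<times> UNIV" "y \<in> F \<times> UNIV" "z \<in> F \<times> UNIV"
  obtain Q where Q: "dual_join J x y Q" "card Q = dual_dist J x y"
    using dual_dist_attained[of x y] xyz by blast
  obtain Q' where Q': "dual_join J y z Q'" "card Q' = dual_dist J y z"
    using dual_dist_attained[of y z] xyz by blast
  have "dual_dist J x z \<le> card (sym_diff Q Q')" by (rule dual_dist_le[OF dual_join_sym_diff[OF Q(1) Q'(1)]])
  also have "\<dots> \<le> card Q + card Q'" using Q(1) Q'(1) fin unfolding dual_join_def by (intro card_sym_diff_le) auto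
  finally show "dual_dist J x z \<le> dual_dist J x y + dual_dist J y z" using Q Q' by simp
qed

text \<open>The three joins add up to a closed one of positive sign, a cut with an even
  side.\<close>

lemma dual_dist_parity:
  assumes "x \<in> F \<times> UNIV" "y \<in> F \<times> UNIV" "z \<in> F \<times> UNIV"
  shows "even (dual_dist J x y + dual_dist J y z + dual_dist J x z)"
proof -
  obtain A where A: "dual_join J x y A" "card A = dual_dist J x y"
    using dual_dist_attained[of x y] assms by blast
  obtain B where B: "dual_join J y z B" "card B = dual_dist J y z"
    using dual_dist_attained[of y z] assms by blast
  obtain C where C: "dual_join J x z C" "card C = dual_dist J x z"
    using dual_dist_attained[of x z] assms by blast
  have f: "finite A" "finite B" "finite C" "finite (sym_diff A B)" using A B C fin unfolding dual_join_def by auto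
  have loop: "dual_join J x x (sym_diff (sym_diff A B) C)"
    by (rule dual_join_sym_diff[OF dual_join_sym_diff[OF A(1) B(1)]]) (use C(1) dual_join_commute in blast)
  obtain X where "X \<subseteq> V" "sym_diff (sym_diff A B) C = bd h E X" "odd (card X) \<longleftrightarrow> snd x \<noteq> snd x"
    "even (card (sym_diff (sym_diff A B) C) + r * card X)"
    by (rule dual_join_loop[OF loop assms(1) refl])
  then have "even (card (sym_diff (sym_diff A B) C))" by simp
  then show ?thesis using odd_card_sym_diff[OF f(4,3)] odd_card_sym_diff[OF f(1,2)] A B C by auto
qed

lemma dual_dist_bar_parity:
  assumes "x \<in> F \<times> UNIV"
  shows "even (dual_dist J x (bar x) + r)"
proof -
  obtain Q where Q: "dual_join J x (bar x) Q" "card Q = dual_dist J x (bar x)"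
    using dual_dist_attained[OF assms bar_in[OF assms]] by blast
  obtain X where X: "X \<subseteq> V" "Q = bd h E X" "odd (card X) \<longleftrightarrow> snd x \<noteq> snd (bar x)" "even (card Q + r * card X)"
    by (rule dual_join_loop[OF Q(1) assms bar_simps(1)])
  have "odd (card X)" using X(3) bar_simps(2)[of x] by simp
  then show ?thesis using Q(2) X(4) by simp
qed

text \<open>Only one copy of each face is kept. An edge of \<open>J\<close> leads to the other copy,
  at distance 1, so the copies that are kept are at distance \<open>r - 1\<close>.\<close>

lemma cube_weights_exist:
  obtains p where "\<forall>x\<in>F. p x x = 0" "\<forall>x\<in>F. \<forall>y\<in>F. p x y = p y x"
    "\<forall>x\<in>F. \<forall>y\<in>F. \<forall>z\<in>F.
      p x z \<le> p x y + p y z \<and> even (p x y + p y z + p x z) \<and> p x y + p y z + p x z \<le> 2 * r"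
    "\<forall>e x y. e \<in> E \<longrightarrow> k e = {x, y} \<longrightarrow> x \<noteq> y \<longrightarrow> p x y = (if e \<in> J then r - 1 else 1)"
proof -
  have b: "\<And>x. x \<in> F \<times> UNIV \<Longrightarrow> bar x \<in> F \<times> UNIV \<and> bar (bar x) = x" unfolding bar_def by auto
  have fX: "finite (F \<times> (UNIV :: bool set))" using finF by simp
  obtain m where m0: "antipodal_metric r (F \<times> UNIV) bar m"
    "\<forall>u\<in>F \<times> UNIV. \<forall>v\<in>F \<times> UNIV. m u v \<le> dual_dist J u v \<and> even (m u v + dual_dist J u v)"
    "\<forall>u\<in>F \<times> UNIV. \<forall>v\<in>F \<times> UNIV. m u v + m u (bar v) = r"
    by (rule tighten[OF fX b dual_dist_metric r2 dual_dist_parity dual_dist_bar_parity])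
  note m = m0(1) m0(2,3)[rule_format]
  have mt: "m u w \<le> m u v + m v w" if "u \<in> F \<times> UNIV" "v \<in> F \<times> UNIV" "w \<in> F \<times> UNIV" for u v w
    using m(1) that unfolding antipodal_metric_def by auto
  have ms: "m u v = m v u" "m (bar u) (bar v) = m u v" "m u u = 0" if "u \<in> F \<times> UNIV" "v \<in> F \<times> UNIV" for u v
    using m(1) that unfolding antipodal_metric_def by auto
  define P where "P H = (H, False)" for H :: 'c
  define p where "p x y = m (P x) (P y)" for x y
  have PF: "P x \<in> F \<times> UNIV" if "x \<in> F" for x using that unfolding P_def by auto
  have par: "even (p x y + p y z + p x z)" if "x \<in> F" "y \<in> F" "z \<in> F" for x y z
    using dual_dist_parity[OF PF[OF that(1)] PF[OF that(2)] PF[OF that(3)]]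
      m(2)[OF PF[OF that(1)] PF[OF that(2)]] m(2)[OF PF[OF that(2)] PF[OF that(3)]] m(2)[OF PF[OF that(1)] PF[OF that(3)]]
    unfolding p_def by auto
  \<comment> \<open>The triangle inequality from \<open>P x\<close> to \<open>P y\<close> through
    the antipode of \<open>P z\<close>.\<close>
  have per: "p x y + p y z + p x z \<le> 2 * r" if "x \<in> F" "y \<in> F" "z \<in> F" for x y z
    using mt[OF PF[OF that(1)] b[THEN conjunct1, OF PF[OF that(3)]] PF[OF that(2)]]
      m(3)[OF PF[OF that(1)] PF[OF that(3)]] m(3)[OF PF[OF that(2)] PF[OF that(3)]]
      ms(1)[OF b[THEN conjunct1, OF PF[OF that(3)]] PF[OF that(2)]]
    unfolding p_def by linarith
  have edge: "p x y = (if e \<in> J then r - 1 else 1)" if e: "e \<in> E" "k e = {x, y}" "x \<noteq> y" for e x y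
  proof -
    have F: "x \<in> F" "y \<in> F" using k(1)[OF e(1)] e(2) by auto
    have dj: "dual_join J (P x) (y, e \<in> J) {e}"
      unfolding dual_join_def odd_deg_singleton P_def using e by (auto simp: Int_insert_left)
    have yF: "(y, e \<in> J) \<in> F \<times> UNIV" using F by auto
    have d1: "dual_dist J (P x) (y, e \<in> J) \<le> 1" using dual_dist_le[OF dj] by simp
    have "dual_dist J (P x) (y, e \<in> J) \<noteq> 0"
    proof
      assume "dual_dist J (P x) (y, e \<in> J) = 0"
      then obtain Q where Q: "dual_join J (P x) (y, e \<in> J) Q" "card Q = 0"
        using dual_dist_attained[OF PF[OF F(1)] yF] by metis
      then have "Q = {}" using fin unfolding dual_join_def by auto
      then show False using Q(1) F e(3) unfolding dual_join_def P_def by auto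
    qed
    \<comment> \<open>Tightening has kept the parity, so the distance 1 cannot have dropped to
      0.\<close>
    then have "m (P x) (y, e \<in> J) \<le> 1 \<and> even (m (P x) (y, e \<in> J) + 1)"
      using m(2)[OF PF[OF F(1)] yF] d1 by (metis One_nat_def Suc_leI le_antisym neq0_conv)
    then have "m (P x) (y, e \<in> J) = 1" by (cases "m (P x) (y, e \<in> J)") auto
    then show ?thesis using m(3)[OF PF[OF F(1)] yF] r2 unfolding p_def P_def bar_def by (cases "e \<in> J") auto
  qed
  show ?thesis
  proof (rule that[of p]; intro ballI allI impI)
    show "p x x = 0" if "x \<in> F" for x unfolding p_def by (rule ms(3)[OF PF PF]; fact)
    show "p x y = p y x" if "x \<in> F" "y \<in> F" for x y unfolding p_def by (rule ms(1)[OF PF PF]; fact)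
    show "p x z \<le> p x y + p y z \<and> even (p x y + p y z + p x z) \<and> p x y + p y z + p x z \<le> 2 * r"
      if "x \<in> F" "y \<in> F" "z \<in> F" for x y z
      using par[OF that] per[OF that] mt[OF PF[OF that(1)] PF[OF that(2)] PF[OF that(3)]] unfolding p_def by auto
  qed (rule edge)
qed

lemma edge_coloring:
  assumes tree: "three_tree W D" and f: "inj_on f F" "f ` F \<subseteq> W"
    and emb: "\<And>e u v. e \<in> E \<Longrightarrow> k e = {u, v} \<Longrightarrow> u \<noteq> v \<Longrightarrow> {f u, f v} \<in> D"
  shows "\<exists>c. (\<forall>e\<in>E. c e < r) \<and> (\<forall>e\<in>E. \<forall>e'\<in>E. e \<noteq> e' \<and> h e \<inter> h e' \<noteq> {} \<longrightarrow> c e \<noteq> c e')"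
proof (cases "F = {}")
  case True
  have "E = {}"
  proof (rule ccontr)
    assume "E \<noteq> {}" then obtain e where "e \<in> E" by auto
    then show False using k[of e] True by auto
  qed
  then show ?thesis by auto
next
  case False
  then obtain H0 where H0: "H0 \<in> F" by auto
  txt \<open>Vertices of the 3-tree that are no faces are identified with the face \<open>H0\<close>.\<close>
  define g where "g w = (if w \<in> f ` F then inv_into F f w else H0)" for w
  have gF: "g w \<in> F" for w unfolding g_def using H0 by (auto simp: inv_into_into)
  have gf: "g (f H) = H" if "H \<in> F" for H unfolding g_def using that f(1) by auto
  obtain p where p0: "\<forall>x\<in>F. p x x = 0" "\<forall>x\<in>F. \<forall>y\<in>F. p x y = p y x"
    "\<forall>x\<in>F. \<forall>y\<in>F. \<forall>z\<in>F.
      p x z \<le> p x y + p y z \<and> even (p x y + p y z + p x z) \<and> p x y + p y z + p x z \<le> 2 * r"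
    "\<forall>e x y. e \<in> E \<longrightarrow> k e = {x, y} \<longrightarrow> x \<noteq> y \<longrightarrow> p x y = (if e \<in> J then r - 1 else 1)"
    by (rule cube_weights_exist)
  note p = p0[rule_format]
  have cw: "cube_weights r (\<lambda>u v. p (g u) (g v))"
    unfolding cube_weights_def
  proof (intro conjI allI)
    fix x y z
    show "p (g x) (g x) = 0" by (rule p(1)[OF gF])
    show "p (g x) (g y) = p (g y) (g x)" by (rule p(2)[OF gF gF])
    show "p (g x) (g z) \<le> p (g x) (g y) + p (g y) (g z)" "even (p (g x) (g y) + p (g y) (g z) + p (g x) (g z))"
      "p (g x) (g y) + p (g y) (g z) + p (g x) (g z) \<le> 2 * r"
      using p(3)[of "g x" "g z" "g y"] p(3)[of "g x" "g y" "g z"] gF by simp_all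
  qed
  obtain \<psi> where \<psi>: "\<And>x. x \<in> W \<Longrightarrow> \<psi> x \<subseteq> {..<r}"
    "\<And>x y. {x, y} \<in> D \<Longrightarrow> card (sym_diff (\<psi> x) (\<psi> y)) = p (g x) (g y)"
    using three_tree_cube_embedding[OF tree cw] by metis
  define \<phi> where "\<phi> H = \<psi> (f H)" for H
  have \<phi>r: "\<phi> H \<subseteq> {..<r}" if "H \<in> F" for H unfolding \<phi>_def using that f(2) by (intro \<psi>(1)) auto
  \<comment> \<open>Along a dual edge one coordinate changes, or all but one if the edge is in
    \<open>J\<close>; the colour is the exceptional coordinate.\<close>
  have ex1: "\<exists>i<r. \<forall>j<r. (card (k e \<inter> {H \<in> F. j \<in> \<phi> H}) = 1) \<noteq> (e \<in> J) \<longleftrightarrow> j = i" if e: "e \<in> E" for e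
  proof -
    obtain x y where xy: "k e = {x, y}" "x \<noteq> y" using k(2)[OF e] by (meson card_2_iff)
    have F: "x \<in> F" "y \<in> F" using k(1)[OF e] xy by auto
    define S where "S = sym_diff (\<phi> x) (\<phi> y)"
    have Sr: "S \<subseteq> {..<r}" unfolding S_def using \<phi>r F by blast
    have cS: "card S = (if e \<in> J then r - 1 else 1)"
      unfolding S_def \<phi>_def using \<psi>(2)[OF emb[OF e xy]] gf F p(4)[OF e xy] by simp
    have iff: "card (k e \<inter> {H \<in> F. j \<in> \<phi> H}) = 1 \<longleftrightarrow> j \<in> S" for j
      unfolding xy card_2_Int_eq_1[OF xy(2)] S_def using F by auto
    show ?thesis
    proof (cases "e \<in> J")
      case True
      have "card ({..<r} - S) = 1" using cS True Sr r2 by (simp add: card_Diff_subset finite_subset)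
      then obtain i where "{..<r} - S = {i}" by (auto simp: card_1_singleton_iff)
      then have i: "j < r \<and> j \<notin> S \<longleftrightarrow> j = i" for j by (metis DiffD1 DiffD2 DiffI lessThan_iff singletonD singletonI)
      then have "i < r" by blast
      moreover have "(j \<in> S) \<noteq> (e \<in> J) \<longleftrightarrow> j = i" if "j < r" for j using i[of j] that True by simp
      ultimately show ?thesis unfolding iff by (intro exI[of _ i]) simp
    next
      case False
      then obtain i where "S = {i}" using cS by (auto simp: card_1_singleton_iff)
      then have "i < r" "(j \<in> S) \<noteq> (e \<in> J) \<longleftrightarrow> j = i" for j using Sr False by simp_all
      then show ?thesis unfolding iff by (intro exI[of _ i]) simp
    qed
  qed
  have "\<exists>c. \<forall>e\<in>E. c e < r \<and> (\<forall>j<r. (card (k e \<inter> {H \<in> F. j \<in> \<phi> H}) = 1) \<noteq> (e \<in> J) \<longleftrightarrow> j = c e)"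
    by (rule bchoice) (use ex1 in blast)
  then obtain c where c0:
    "\<forall>e\<in>E. c e < r \<and> (\<forall>j<r. (card (k e \<inter> {H \<in> F. j \<in> \<phi> H}) = 1) \<noteq> (e \<in> J) \<longleftrightarrow> j = c e)" by blast
  have c: "c e < r" "\<And>j. j < r \<Longrightarrow> (card (k e \<inter> {H \<in> F. j \<in> \<phi> H}) = 1) \<noteq> (e \<in> J) \<longleftrightarrow> j = c e"
    if "e \<in> E" for e using c0 that by blast+
  \<comment> \<open>Every colour class has odd degree at \<open>v\<close>, so all \<open>r\<close>
    colours occur there; as \<open>v\<close> has \<open>r\<close> edges, each occurs once.\<close>
  have inj: "inj_on c {e \<in> E. v \<in> h e}" if v: "v \<in> V" for v
  proof (rule eq_card_imp_inj_on)
    show "finite {e \<in> E. v \<in> h e}" using finE by auto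
    have "j \<in> c ` {e \<in> E. v \<in> h e}" if j: "j < r" for j
    proof -
      define Z where "Z = bd k E {H \<in> F. j \<in> \<phi> H}"
      have ZE: "Z \<subseteq> E" unfolding Z_def bd_def by auto
      have "\<exists>S\<subseteq>F. Z = bd k E S" unfolding Z_def by (intro exI[of _ "{H \<in> F. j \<in> \<phi> H}"]) auto
      then have ev: "even (deg h Z v)" using cycles_are_dual_cuts[OF ZE] v by simp
      have eq: "{e \<in> E. c e = j} = sym_diff Z J"
      proof (rule set_eqI)
        fix e
        show "e \<in> {e \<in> E. c e = j} \<longleftrightarrow> e \<in> sym_diff Z J"
        proof (cases "e \<in> E")
          case True
          then show ?thesis using c(2)[OF True j] unfolding Z_def bd_def by simp blast
        next
          case False
          then show ?thesis using ZE JE by auto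
        qed
      qed
      have "odd (deg h {e \<in> E. c e = j} v)"
        unfolding eq odd_deg_sym_diff[OF fin[OF ZE] fin[OF JE]] using ev J[OF v] by blast
      then have "{e \<in> {e \<in> E. c e = j}. v \<in> h e} \<noteq> {}" unfolding deg_def by (metis card.empty even_zero)
      then show ?thesis by auto
    qed
    then have "c ` {e \<in> E. v \<in> h e} = {..<r}" using c(1) by auto
    then show "card (c ` {e \<in> E. v \<in> h e}) = card {e \<in> E. v \<in> h e}"
      using regular[OF v] unfolding deg_def by simp
  qed
  have "c e \<noteq> c e'" if "e \<in> E" "e' \<in> E" "e \<noteq> e'" "h e \<inter> h e' \<noteq> {}" for e e'
  proof -
    obtain v where v: "v \<in> h e" "v \<in> h e'" using \<open>h e \<inter> h e' \<noteq> {}\<close> by blast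
    then have "v \<in> V" using h(1)[OF \<open>e \<in> E\<close>] by blast
    from inj[OF this] show ?thesis using that v by (auto dest: inj_onD)
  qed
  then show ?thesis using c(1) by blast
qed

end

section \<open>Duality of plane graphs\<close>

text \<open>A nonempty open subset of the plane has no continuous injection into an interval. This
  yields points off an edge arbitrarily close to it.\<close>

lemma open_subset_arc_image_empty:
  fixes g :: "real \<Rightarrow> complex"
  assumes "arc g" "open U" "U \<subseteq> path_image g"
  shows "U = {}"
proof (rule ccontr)
  assume "U \<noteq> {}"
  have "path_image g homeomorphic {0..1::real}" by (rule homeomorphic_arc_image_interval[OF assms(1)]) simp
  then obtain f f' where f: "homeomorphism (path_image g) {0..1::real} f f'" unfolding homeomorphic_def by blast
  have "continuous_on U f" using homeomorphism_cont1[OF f] assms(3) by (rule continuous_on_subset)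
  moreover have "inj_on f U"
    using homeomorphism_apply1[OF f] assms(3) by (intro inj_on_inverseI[of _ f']) blast
  ultimately have "DIM(complex) \<le> DIM(real)" using assms(2) \<open>U \<noteq> {}\<close> by (intro invariance_of_dimension)
  then show False by simp
qed

locale plane_graph =
  fixes V :: "complex set" and E :: "'e set" and h :: "'e \<Rightarrow> complex set" and \<gamma> :: "'e \<Rightarrow> real \<Rightarrow> complex"
  assumes finV: "finite V" and finE: "finite E"
    and h: "e \<in> E \<Longrightarrow> h e \<subseteq> V" "e \<in> E \<Longrightarrow> card (h e) = 2"
    and arc: "e \<in> E \<Longrightarrow> arc (\<gamma> e)"
    and ends: "e \<in> E \<Longrightarrow> {pathstart (\<gamma> e), pathfinish (\<gamma> e)} = h e"
    and avoid_verts: "e \<in> E \<Longrightarrow> \<gamma> e ` {0<..<1} \<inter> V = {}"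
    and avoid_edges: "e \<in> E \<Longrightarrow> e' \<in> E \<Longrightarrow> e' \<noteq> e \<Longrightarrow> \<gamma> e ` {0<..<1} \<inter> path_image (\<gamma> e') = {}"
begin

definition img :: "'e \<Rightarrow> complex set" where "img e = path_image (\<gamma> e)"
definition opn :: "'e \<Rightarrow> complex set" where "opn e = \<gamma> e ` {0<..<1}"
definition pt :: "'e \<Rightarrow> complex" where "pt e = \<gamma> e (1/2)"
text \<open>All vertices belong to the support whatever \<open>Z\<close> is, so adding an edge to
  \<open>Z\<close> adds just its interior.\<close>

definition support :: "'e set \<Rightarrow> complex set" where "support Z = V \<union> \<Union>(img ` Z)"

lemma img_eq: "e \<in> E \<Longrightarrow> img e = opn e \<union> h e"
proof -
  assume e: "e \<in> E"
  have "{0..1::real} = {0<..<1} \<union> {0, 1}" by auto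
  then show "img e = opn e \<union> h e"
    unfolding img_def opn_def path_image_def ends[OF e, symmetric] pathstart_def pathfinish_def by auto
qed

lemma img_Int_V: "e \<in> E \<Longrightarrow> img e \<inter> V = h e"
  using img_eq[of e] avoid_verts[of e] h(1)[of e] unfolding opn_def by auto

lemma img_Int_img: "e \<in> E \<Longrightarrow> e' \<in> E \<Longrightarrow> e \<noteq> e' \<Longrightarrow> img e \<inter> img e' \<subseteq> V"
  using img_eq[of e] avoid_edges[of e e'] h(1)[of e] unfolding opn_def img_def by auto

lemma opn_Int_support: "e \<in> E \<Longrightarrow> Z \<subseteq> E - {e} \<Longrightarrow> opn e \<inter> support Z = {}"
  using avoid_edges[of e] avoid_verts[of e] unfolding support_def opn_def img_def by blast

lemma img_Int_support: "e \<in> E \<Longrightarrow> Z \<subseteq> E - {e} \<Longrightarrow> img e \<inter> support Z = h e"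
  using opn_Int_support[of e Z] img_eq[of e] h(1)[of e] unfolding support_def by blast

lemma pt_opn: "pt e \<in> opn e"
  unfolding pt_def opn_def by (intro imageI) auto

lemma pt_img: "e \<in> E \<Longrightarrow> pt e \<in> img e"
  using pt_opn img_eq by blast

lemma pt_notin_img: "e \<in> E \<Longrightarrow> e' \<in> E \<Longrightarrow> e' \<noteq> e \<Longrightarrow> pt e \<notin> img e'"
  using avoid_edges[of e e'] pt_opn[of e] unfolding img_def opn_def by blast

lemma connected_opn: "e \<in> E \<Longrightarrow> connected (opn e)"
proof -
  assume e: "e \<in> E"
  have "continuous_on {0<..<1} (\<gamma> e)"
    by (rule continuous_on_subset[of "{0..1}"]) (use arc[OF e] in \<open>auto simp: arc_def path_def\<close>)
  then show "connected (opn e)" unfolding opn_def by (rule connected_continuous_image) auto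
qed

lemma compact_img: "e \<in> E \<Longrightarrow> compact (img e)"
  unfolding img_def using arc by (intro compact_path_image arc_imp_path)

lemma compact_Union_img: "Z \<subseteq> E \<Longrightarrow> compact (\<Union>(img ` Z))"
  using finE compact_img finite_subset by (intro compact_Union finite_imageI) blast+

lemma compact_support: "Z \<subseteq> E \<Longrightarrow> compact (support Z)"
  unfolding support_def by (intro compact_Un compact_Union_img finite_imp_compact finV)

lemma closed_support: "Z \<subseteq> E \<Longrightarrow> closed (support Z)"
  by (intro compact_imp_closed compact_support)

lemma support_insert: "support (insert e Z) = support Z \<union> img e"
  unfolding support_def by auto

lemma oriented_edge:
  assumes "e \<in> E" "h e = {u, w}"
  obtains g where "arc g" "pathstart g = u" "pathfinish g = w" "path_image g = img e"
proof -
  have "pathstart (\<gamma> e) \<noteq> pathfinish (\<gamma> e)" using arc_distinct_ends[OF arc[OF assms(1)]] by auto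
  then consider "pathstart (\<gamma> e) = u" "pathfinish (\<gamma> e) = w" | "pathstart (\<gamma> e) = w" "pathfinish (\<gamma> e) = u"
    using ends[OF assms(1)] assms(2) by (auto simp: doubleton_eq_iff)
  then show ?thesis
  proof cases
    case 1 then show ?thesis using that[of "\<gamma> e"] arc[OF assms(1)] unfolding img_def by blast
  next
    case 2 then show ?thesis
      using that[of "reversepath (\<gamma> e)"] arc_reversepath[OF arc[OF assms(1)]] unfolding img_def by simp
  qed
qed

section \<open>Cycles through an edge as closed curves\<close>

definition short_arc :: "'e set \<Rightarrow> complex \<Rightarrow> complex \<Rightarrow> nat \<Rightarrow> 'e set \<Rightarrow> (real \<Rightarrow> complex) \<Rightarrow> bool" where
  "short_arc Z u v n P g \<longleftrightarrow> P \<subseteq> Z \<and> arc g \<and> pathstart g = u \<and> pathfinish g = v \<and> path_image g = \<Union>(img ` P) \<and>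
    (\<forall>x. odd (deg h P x) \<longleftrightarrow> (x = u) \<noteq> (x = v)) \<and> (\<forall>x \<in> V \<inter> path_image g. \<exists>m\<le>n. (x, v) \<in> adj h Z ^^ m)"

lemma short_arcD:
  assumes "short_arc Z u v n P g"
  shows "P \<subseteq> Z" "arc g" "pathstart g = u" "pathfinish g = v" "path_image g = \<Union>(img ` P)"
    "odd (deg h P x) \<longleftrightarrow> (x = u) \<noteq> (x = v)" "x \<in> V \<inter> path_image g \<Longrightarrow> \<exists>m\<le>n. (x, v) \<in> adj h Z ^^ m"
  using assms unfolding short_arc_def by blast+

text \<open>A shortest walk is traced by an arc: its first vertex is too far from \<open>v\<close> to recur.\<close>

lemma shortest_arc:
  assumes "Z \<subseteq> E" "(u, v) \<in> adj h Z ^^ n" "\<And>m. m < n \<Longrightarrow> (u, v) \<notin> adj h Z ^^ m" "n > 0"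
  shows "\<exists>P g. short_arc Z u v n P g"
  using assms(2-4)
proof (induction n arbitrary: u)
  case 0
  then show ?case by simp
next
  case (Suc k)
  obtain w where w: "(u, w) \<in> adj h Z" "(w, v) \<in> adj h Z ^^ k" using Suc.prems(1) by (rule relpow_Suc_E2)
  obtain e where e: "e \<in> Z" "h e = {u, w}" using w(1) unfolding adj_def by auto
  have eE: "e \<in> E" using e(1) assms(1) by auto
  have uw: "u \<noteq> w" using h(2)[OF eE] e(2) by auto
  obtain g0 where g0: "arc g0" "pathstart g0 = u" "pathfinish g0 = w" "path_image g0 = img e"
    by (rule oriented_edge[OF eE e(2)])
  have VI: "V \<inter> img e = {u, w}" using img_Int_V[OF eE] e(2) by auto
  show ?case
  proof (cases "k = 0")
    case True
    then have wv: "w = v" using w(2) by simp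
    have "\<forall>x. odd (deg h {e} x) \<longleftrightarrow> (x = u) \<noteq> (x = v)" unfolding odd_deg_singleton e(2) wv using uw wv by auto
    moreover have "\<exists>m\<le>Suc k. (x, v) \<in> adj h Z ^^ m" if "x \<in> V \<inter> path_image g0" for x
    proof -
      have "x = u \<or> x = v" using that VI g0(4) wv by auto
      then show ?thesis
      proof
        assume "x = u" then show ?thesis using Suc.prems(1) by blast
      next
        assume "x = v" then have "(x, v) \<in> adj h Z ^^ 0" by simp
        then show ?thesis by blast
      qed
    qed
    moreover have "path_image g0 = \<Union>(img ` {e})" using g0(4) by simp
    moreover have "{e} \<subseteq> Z" using e(1) by simp
    ultimately have "short_arc Z u v (Suc k) {e} g0" unfolding short_arc_def using g0(1-3) wv by blast
    then show ?thesis by blast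
  next
    case False
    have minw: "(w, v) \<notin> adj h Z ^^ m" if "m < k" for m
    proof
      assume "(w, v) \<in> adj h Z ^^ m"
      then have "(u, v) \<in> adj h Z ^^ Suc m" by (rule relpow_Suc_I2[OF w(1)])
      then show False using Suc.prems(2)[of "Suc m"] that by simp
    qed
    have "k > 0" using False by simp
    obtain P g where "short_arc Z w v k P g" using Suc.IH[OF w(2) minw \<open>k > 0\<close>] by blast
    note P = short_arcD[OF this]
    have u: "u \<notin> path_image g"
    proof
      assume "u \<in> path_image g"
      moreover have "u \<in> V" using h(1)[OF eE] e(2) by auto
      ultimately obtain m where "m \<le> k" "(u, v) \<in> adj h Z ^^ m" using P(7) by blast
      then show False using Suc.prems(2)[of m] by simp
    qed
    have "u \<in> img e" using img_eq[OF eE] e(2) by auto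
    then have eP: "e \<notin> P" using u P(5) by auto
    have "img e \<inter> img e' \<subseteq> V" if "e' \<in> P" for e'
      by (rule img_Int_img) (use that eE eP P(1) assms(1) in auto)
    then have "img e \<inter> path_image g \<subseteq> V \<inter> img e" unfolding P(5) by blast
    then have Int: "path_image g0 \<inter> path_image g \<subseteq> {w}" using u unfolding VI g0(4) by blast
    have fP: "finite P" using P(1) assms(1) finE by (meson finite_subset)
    have ins: "insert e P = sym_diff P {e}" using eP by auto
    have "odd (deg h (insert e P) x) \<longleftrightarrow> (x = u) \<noteq> (x = v)" for x
    proof -
      have "x \<in> h e \<longleftrightarrow> (x = u) \<noteq> (x = w)" using e(2) uw by auto
      then show ?thesis unfolding ins odd_deg_sym_diff[OF fP finite.insertI[OF finite.emptyI]] odd_deg_singleton P(6) by blast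
    qed
    moreover have "arc (g0 +++ g)" by (rule arc_join[OF g0(1) P(2)]) (use g0 P Int in auto)
    moreover have pi: "path_image (g0 +++ g) = \<Union>(img ` insert e P)"
      using g0 P by (simp add: path_image_join)
    moreover have "\<exists>m\<le>Suc k. (x, v) \<in> adj h Z ^^ m" if x: "x \<in> V \<inter> path_image (g0 +++ g)" for x
    proof -
      have "x = u \<or> x = w \<or> x \<in> V \<inter> path_image g" using x VI unfolding pi P(5) by auto
      then show ?thesis
      proof (elim disjE)
        assume "x = u" then show ?thesis using Suc.prems(1) by blast
      next
        assume "x = w" then show ?thesis using w(2) le_SucI by blast
      next
        assume "x \<in> V \<inter> path_image g" then show ?thesis using P(7) le_SucI by blast
      qed
    qed
    moreover have "insert e P \<subseteq> Z" using P(1) e(1) by simp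
    moreover have "pathstart (g0 +++ g) = u" "pathfinish (g0 +++ g) = v" using g0(2) P(4) by simp_all
    ultimately have "short_arc Z u v (Suc k) (insert e P) (g0 +++ g)" unfolding short_arc_def by blast
    then show ?thesis by blast
  qed
qed

text \<open>\<open>P\<close> is the cycle without \<open>e\<close>, a path between its ends. The
  clauses are what Jordan's theorem, the cycle space and Janiszewski's theorem will ask for.\<close>

definition cycle_through :: "'e \<Rightarrow> 'e set \<Rightarrow> bool" where
  "cycle_through e P \<longleftrightarrow> e \<notin> P \<and> connected (\<Union>(img ` P)) \<and> h e \<subseteq> \<Union>(img ` P) \<and>
    (\<forall>x. even (deg h (insert e P) x)) \<and>
    (\<exists>c. simple_path c \<and> pathfinish c = pathstart c \<and> path_image c = \<Union>(img ` insert e P))"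

lemma cycle_through_exists:
  assumes "e \<in> E" "Z \<subseteq> E - {e}" "h e = {u, v}" "(u, v) \<in> (adj h Z)\<^sup>*"
  obtains P where "P \<subseteq> Z" "cycle_through e P"
proof -
  have uv: "u \<noteq> v" using h(2)[OF assms(1)] assms(3) by auto
  have ZE: "Z \<subseteq> E" using assms(2) by auto
  obtain n0 where "(u, v) \<in> adj h Z ^^ n0" using assms(4) rtrancl_imp_relpow by blast
  define n where "n = (LEAST n. (u, v) \<in> adj h Z ^^ n)"
  have n: "(u, v) \<in> adj h Z ^^ n" "\<And>m. m < n \<Longrightarrow> (u, v) \<notin> adj h Z ^^ m"
    unfolding n_def using \<open>(u, v) \<in> adj h Z ^^ n0\<close> by (rule LeastI) (rule not_less_Least)
  have "n > 0" using n(1) uv by (cases n) auto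
  have "\<exists>P g. short_arc Z u v n P g" by (rule shortest_arc[OF ZE n(1) n(2) \<open>n > 0\<close>])
  then obtain P g where "short_arc Z u v n P g" by blast
  note P = short_arcD[OF this]
  have eP: "e \<notin> P" using P(1) assms(2) by auto
  have "h e = {v, u}" using assms(3) by auto
  then obtain g0 where g0: "arc g0" "pathstart g0 = v" "pathfinish g0 = u" "path_image g0 = img e"
    by (rule oriented_edge[OF assms(1)])
  have "\<Union>(img ` P) \<subseteq> support Z" unfolding support_def using P(1) by auto
  then have Int: "path_image g \<inter> path_image g0 \<subseteq> {u, v}"
    using img_Int_support[OF assms(1,2)] unfolding g0(4) P(5) assms(3) by blast
  have "simple_path (g +++ g0)"
    by (rule simple_path_join_loop[OF P(2) g0(1)]) (use P g0 Int in auto)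
  moreover have "path_image (g +++ g0) = \<Union>(img ` insert e P)" using P g0 by (simp add: path_image_join Un_commute)
  moreover have "pathfinish (g +++ g0) = pathstart (g +++ g0)" using P g0 by simp
  moreover have "even (deg h (insert e P) x)" for x
  proof -
    have ins: "insert e P = sym_diff P {e}" using eP by auto
    have fP: "finite P" using P(1) ZE finE by (meson finite_subset)
    have "x \<in> h e \<longleftrightarrow> (x = u) \<noteq> (x = v)" using assms(3) uv by auto
    then show ?thesis
      using odd_deg_sym_diff[OF fP finite.insertI[OF finite.emptyI], of h e x] odd_deg_singleton[of h e x] P(6)[of x]
      unfolding ins by blast
  qed
  moreover have "connected (\<Union>(img ` P))" unfolding P(5)[symmetric] using P(2) by (intro connected_path_image arc_imp_path)
  moreover have "h e \<subseteq> \<Union>(img ` P)"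
    unfolding P(5)[symmetric] assms(3) using pathstart_in_path_image[of g] pathfinish_in_path_image[of g] P(3,4) by simp
  ultimately have "cycle_through e P" unfolding cycle_through_def using eP by blast
  then show ?thesis using that P(1) by blast
qed

section \<open>Separation by a cycle and by a bridge\<close>

lemma cycle_throughD:
  assumes "cycle_through e P" "K = \<Union>(img ` insert e P)"
  shows "open (inside K)" "connected (inside K)" "open (outside K)" "connected (outside K)"
    "inside K \<inter> outside K = {}" "inside K \<union> outside K = - K" "frontier (inside K) = K" "frontier (outside K) = K"
proof -
  obtain c where c: "simple_path c" "pathfinish c = pathstart c" "path_image c = K"
    using assms unfolding cycle_through_def by blast
  show "open (inside K)" "connected (inside K)" "open (outside K)" "connected (outside K)"
    "inside K \<inter> outside K = {}" "inside K \<union> outside K = - K" "frontier (inside K) = K" "frontier (outside K) = K"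
    using Jordan_inside_outside[OF c(1,2)] unfolding c(3) by simp_all
qed

text \<open>The cycle meets the graph without \<open>e\<close> in exactly \<open>P\<close>, which is
  connected, so Janiszewski's theorem applies to these two.\<close>

lemma cycle_nonseparating:
  assumes e: "e \<in> E" and Z: "Z \<subseteq> E - {e}" and P: "P \<subseteq> Z" "cycle_through e P"
    and K: "K = \<Union>(img ` insert e P)"
    and ab: "connected_component (- support Z) a b" "a \<notin> K" "b \<notin> K" "a \<in> inside K \<longleftrightarrow> b \<in> inside K"
  shows "connected_component (- support (insert e Z)) a b"
proof -
  note J = cycle_throughD[OF P(2) K]
  have "compact K" unfolding K by (rule compact_Union_img) (use e Z P in auto)
  moreover have "closed (support Z)" by (rule closed_support) (use Z in auto)
  moreover have "K \<inter> support Z = \<Union>(img ` P)"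
  proof -
    have "\<Union>(img ` P) \<subseteq> support Z" using P(1) unfolding support_def by auto
    moreover have "img e \<inter> support Z \<subseteq> \<Union>(img ` P)"
      using img_Int_support[OF e Z] P(2) unfolding cycle_through_def by blast
    ultimately show ?thesis unfolding K by auto
  qed
  then have "connected (K \<inter> support Z)" using P(2) unfolding cycle_through_def by simp
  moreover have "connected_component (- K) a b"
  proof (cases "a \<in> inside K")
    case True
    then have "b \<in> inside K" using ab(4) by simp
    moreover have "inside K \<subseteq> - K" using J(6) by blast
    ultimately show ?thesis using True J(2) unfolding connected_component_def by blast
  next
    case False
    then have "a \<in> outside K" "b \<in> outside K" using J(6) ab by blast+
    moreover have "outside K \<subseteq> - K" using J(6) by blast
    ultimately show ?thesis using J(4) unfolding connected_component_def by blast
  qed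
  ultimately have "connected_component (- (K \<union> support Z)) a b" using ab(1) by (intro Janiszewski)
  moreover have "K \<union> support Z = support (insert e Z)" using P(1) unfolding K support_def by auto
  ultimately show ?thesis by simp
qed

text \<open>A bridge meets the rest of the graph in two points, which is not a connected set. So
  Janiszewski's theorem is applied twice: the bridge is joined first to the part \<open>S\<close>
  reachable from \<open>u\<close>, then to the remainder \<open>T\<close>, and each time the
  intersection is a single point.\<close>

lemma bridge_nonseparating:
  assumes e: "e \<in> E" and Z: "Z \<subseteq> E - {e}" and uv: "h e = {u, v}" "(u, v) \<notin> (adj h Z)\<^sup>*"
    and ab: "connected_component (- support Z) a b" "a \<notin> img e" "b \<notin> img e"
  shows "connected_component (- support (insert e Z)) a b"
proof -
  define R where "R = {w. (u, w) \<in> (adj h Z)\<^sup>*}"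
  define S where "S = (V \<inter> R) \<union> \<Union>(img ` {e' \<in> Z. h e' \<subseteq> R})"
  define T where "T = (V - R) \<union> \<Union>(img ` {e' \<in> Z. h e' \<inter> R = {}})"
  have ZE: "\<And>e'. e' \<in> Z \<Longrightarrow> e' \<in> E" using Z by auto
  have split: "h e' \<subseteq> R \<or> h e' \<inter> R = {}" if e': "e' \<in> Z" for e'
  proof -
    obtain x y where xy: "h e' = {x, y}" "x \<noteq> y" using h(2)[OF ZE[OF e']] by (meson card_2_iff)
    have "bd h Z R = {}" unfolding R_def by (rule bd_reach_empty) (use h ZE in auto)
    then have "card (h e' \<inter> R) \<noteq> 1" using e' unfolding bd_def by blast
    then show ?thesis unfolding xy card_2_Int_eq_1[OF xy(2)] by blast
  qed
  have ST: "S \<union> T = support Z" unfolding S_def T_def support_def using split by blast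
  have SV: "S \<inter> V \<subseteq> R" unfolding S_def using img_Int_V ZE by blast
  have TV: "T \<inter> V \<inter> R = {}" unfolding T_def using img_Int_V ZE by blast
  have "S \<inter> T \<subseteq> V"
  proof
    fix x assume x: "x \<in> S \<inter> T"
    show "x \<in> V"
    proof (rule ccontr)
      assume "x \<notin> V"
      then obtain e1 e2 where 1: "e1 \<in> Z" "h e1 \<subseteq> R" "x \<in> img e1" "e2 \<in> Z" "h e2 \<inter> R = {}" "x \<in> img e2"
        using x unfolding S_def T_def by auto
      then have "h e1 \<noteq> {}" using h(2)[OF ZE] by fastforce
      then have "e1 \<noteq> e2" using 1 by blast
      then show False using img_Int_img[OF ZE ZE] 1 \<open>x \<notin> V\<close> by blast
    qed
  qed
  then have disj: "S \<inter> T = {}" using SV TV by blast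
  have V: "u \<in> V" "v \<in> V" using h(1)[OF e] uv by auto
  have uR: "u \<in> R" "v \<notin> R" unfolding R_def using uv by auto
  have uvST: "u \<in> S" "v \<in> T" "u \<notin> T" "v \<notin> S" using V uR SV TV unfolding S_def T_def by blast+
  have imgZ: "img e \<inter> (S \<union> T) = {u, v}" unfolding ST using img_Int_support[OF e Z] uv by simp
  have cS: "compact S" unfolding S_def
    by (intro compact_Un compact_Union_img finite_imp_compact) (use finV Z in auto)
  have cT: "compact T" unfolding T_def
    by (intro compact_Un compact_Union_img finite_imp_compact) (use finV Z in auto)
  have sub: "- support Z \<subseteq> - S" "- support Z \<subseteq> - T" using ST by blast+
  have cc: "connected_component (- (img e \<union> S)) a b"
  proof (rule Janiszewski[OF compact_img[OF e] compact_imp_closed[OF cS]])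
    have "img e \<inter> S = {u}" using imgZ uvST by blast
    then show "connected (img e \<inter> S)" by simp
    have "connected (- img e)" unfolding img_def by (rule connected_arc_complement[OF arc[OF e]]) simp
    then show "connected_component (- img e) a b" using ab(2,3) unfolding connected_component_def by blast
    show "connected_component (- S) a b" by (rule connected_component_of_subset[OF ab(1) sub(1)])
  qed
  have "connected_component (- ((img e \<union> S) \<union> T)) a b"
  proof (rule Janiszewski[OF compact_Un[OF compact_img[OF e] cS] compact_imp_closed[OF cT]])
    have "(img e \<union> S) \<inter> T = {v}" using imgZ uvST disj by blast
    then show "connected ((img e \<union> S) \<inter> T)" by simp
    show "connected_component (- (img e \<union> S)) a b" by (rule cc)
    show "connected_component (- T) a b" by (rule connected_component_of_subset[OF ab(1) sub(2)])
  qed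
  moreover have "(img e \<union> S) \<union> T = support (insert e Z)" unfolding support_insert ST[symmetric] by blast
  ultimately show ?thesis by simp
qed

text \<open>The arcs may be wild, so that a small disc minus an edge may have infinitely many components. The
  two sides of \<open>e\<close> are therefore found in the face of the graph without \<open>e\<close> that contains \<open>e\<close>, whereas
  \<open>crossing\<close> only inspects a neighbourhood of one point of \<open>e\<close> and ignores the other edges.\<close>

definition locus :: "'e set \<Rightarrow> 'e \<Rightarrow> complex set" where
  "locus Z e = connected_component_set (- support Z) (pt e) - img e"

text \<open>A set of faces is represented by a predicate on points, whose values on the support are
  immaterial; thus one predicate can be read in graphs with different edges.\<close>

definition face_const :: "'e set \<Rightarrow> (complex \<Rightarrow> bool) \<Rightarrow> bool" where
  "face_const W \<xi> \<longleftrightarrow> (\<forall>a b. connected_component (- support W) a b \<longrightarrow> \<xi> a = \<xi> b)"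

lemma face_constD: "face_const W \<xi> \<Longrightarrow> connected_component (- support W) a b \<Longrightarrow> \<xi> a = \<xi> b"
  unfolding face_const_def by blast

definition crossing :: "'e set \<Rightarrow> (complex \<Rightarrow> bool) \<Rightarrow> 'e \<Rightarrow> bool" where
  "crossing W \<xi> e \<longleftrightarrow> (\<forall>\<epsilon>>0. \<exists>a b. a \<in> ball (pt e) \<epsilon> - support W \<and> b \<in> ball (pt e) \<epsilon> - support W \<and> \<xi> a \<noteq> \<xi> b)"

section \<open>The two sides of an edge\<close>

lemma opn_component:
  assumes "e \<in> E" "Z \<subseteq> E - {e}"
  shows "opn e \<subseteq> connected_component_set (- support Z) (pt e)"
  by (rule connected_component_maximal[OF pt_opn connected_opn]) (use assms opn_Int_support[OF assms] in auto)

lemma locus_subset: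
  "locus Z e \<subseteq> - support (insert e Z)"
  unfolding locus_def support_insert using connected_component_subset[of "- support Z" "pt e"] by auto

lemma locus_near:
  assumes "e \<in> E" "Z \<subseteq> E - {e}" "q \<in> opn e"
  obtains \<epsilon> where "\<epsilon> > 0" "\<And>z. z \<in> ball q \<epsilon> \<Longrightarrow> z \<notin> img e \<Longrightarrow> z \<in> locus Z e"
    "\<And>z. z \<in> ball q \<epsilon> \<Longrightarrow> z \<notin> support Z"
proof -
  define H where "H = connected_component_set (- support Z) (pt e)"
  have "open H" unfolding H_def by (intro open_connected_component open_Compl closed_support) (use assms in auto)
  moreover have "q \<in> H" unfolding H_def using opn_component[OF assms(1,2)] assms(3) by blast
  ultimately obtain \<epsilon> where e: "\<epsilon> > 0" "ball q \<epsilon> \<subseteq> H" using open_contains_ball by blast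
  have H: "H \<subseteq> - support Z" unfolding H_def by (rule connected_component_subset)
  show ?thesis
  proof (rule that[OF e(1)])
    fix z assume "z \<in> ball q \<epsilon>"
    then have "z \<in> H" using e(2) by blast
    then show "z \<notin> support Z" using H by blast
    assume "z \<notin> img e"
    then show "z \<in> locus Z e" using \<open>z \<in> H\<close> unfolding locus_def H_def by blast
  qed
qed

text \<open>By Jordan's theorem both sides of the cycle come close to every point of
  \<open>e\<close>, and by \<open>cycle_nonseparating\<close> the part of the locus on one side lies
  in one face.\<close>

lemma cycle_locus_sides:
  assumes "e \<in> E" "Z \<subseteq> E - {e}" "P \<subseteq> Z" "cycle_through e P" "K = \<Union>(img ` insert e P)"
  shows "locus Z e \<subseteq> inside K \<union> outside K"
    "\<And>a b. a \<in> locus Z e \<Longrightarrow> b \<in> locus Z e \<Longrightarrow> a \<in> inside K \<longleftrightarrow> b \<in> inside K \<Longrightarrow>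
      connected_component (- support (insert e Z)) a b"
    "\<And>q \<epsilon>. q \<in> opn e \<Longrightarrow> \<epsilon> > 0 \<Longrightarrow> \<exists>a b. a \<in> ball q \<epsilon> \<inter> locus Z e \<inter> inside K \<and> b \<in> ball q \<epsilon> \<inter> locus Z e \<inter> outside K"
proof -
  note J = cycle_throughD[OF assms(4,5)]
  have "K \<subseteq> support (insert e Z)" unfolding assms(5) support_def using assms(3) by auto
  then have LK: "locus Z e \<inter> K = {}" using locus_subset[of Z e] by blast
  then show "locus Z e \<subseteq> inside K \<union> outside K" unfolding J(6) by blast
  show "connected_component (- support (insert e Z)) a b"
    if "a \<in> locus Z e" "b \<in> locus Z e" "a \<in> inside K \<longleftrightarrow> b \<in> inside K" for a b
  proof (rule cycle_nonseparating[OF assms(1-5)])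
    have "connected_component (- support Z) (pt e) a" "connected_component (- support Z) (pt e) b"
      using that(1,2) unfolding locus_def by auto
    then show "connected_component (- support Z) a b"
      using connected_component_trans connected_component_sym by metis
  qed (use that LK in auto)
  show "\<exists>a b. a \<in> ball q \<epsilon> \<inter> locus Z e \<inter> inside K \<and> b \<in> ball q \<epsilon> \<inter> locus Z e \<inter> outside K"
    if q: "q \<in> opn e" and \<epsilon>: "\<epsilon> > 0" for q \<epsilon>
  proof -
    obtain \<delta> where \<delta>: "\<delta> > 0" "\<And>z. z \<in> ball q \<delta> \<Longrightarrow> z \<notin> img e \<Longrightarrow> z \<in> locus Z e"
      using locus_near[OF assms(1,2) q] by metis
    have "q \<in> K" using q img_eq[OF assms(1)] unfolding assms(5) by auto
    then have "q \<in> closure (inside K)" "q \<in> closure (outside K)" using J(7,8) unfolding frontier_def by blast+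
    moreover have "min \<epsilon> \<delta> > 0" using \<epsilon> \<delta>(1) by simp
    ultimately obtain a b where ab: "a \<in> inside K" "dist a q < min \<epsilon> \<delta>" "b \<in> outside K" "dist b q < min \<epsilon> \<delta>"
      unfolding closure_approachable by blast
    have eK: "img e \<subseteq> K" unfolding assms(5) by auto
    have "a \<notin> K" "b \<notin> K" using ab(1,3) J(6) by blast+
    moreover have "a \<in> ball q \<epsilon>" "b \<in> ball q \<epsilon>" "a \<in> ball q \<delta>" "b \<in> ball q \<delta>" using ab(2,4) by (simp_all add: dist_commute)
    ultimately show ?thesis using \<delta>(2) eK ab(1,3) by blast
  qed
qed

text \<open>\<open>A\<close> is the inside of a cycle through \<open>e\<close>, or empty if there is
  none. So the locus meets at most two faces, and each of them comes arbitrarily close to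
  \<open>pt e\<close>.\<close>

lemma two_sides:
  assumes "e \<in> E" "Z \<subseteq> E - {e}"
  obtains A where "\<forall>a\<in>locus Z e. \<forall>b\<in>locus Z e. (a \<in> A \<longleftrightarrow> b \<in> A) \<longrightarrow> connected_component (- support (insert e Z)) a b"
    "\<forall>\<epsilon>>0. \<forall>a\<in>locus Z e. \<exists>a'. a' \<in> ball (pt e) \<epsilon> \<inter> locus Z e \<and> (a' \<in> A \<longleftrightarrow> a \<in> A)"
proof -
  obtain u v where uv: "h e = {u, v}" using h(2)[OF assms(1)] by (meson card_2_iff)
  show ?thesis
  proof (cases "(u, v) \<in> (adj h Z)\<^sup>*")
    case True
    obtain P where P: "P \<subseteq> Z" "cycle_through e P" by (rule cycle_through_exists[OF assms uv True])
    define K where "K = \<Union>(img ` insert e P)"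
    note S = cycle_locus_sides[OF assms P K_def] and J = cycle_throughD[OF P(2) K_def]
    show ?thesis
    proof (rule that[of "inside K"]; intro ballI allI impI)
      show "connected_component (- support (insert e Z)) a b"
        if "a \<in> locus Z e" "b \<in> locus Z e" "a \<in> inside K \<longleftrightarrow> b \<in> inside K" for a b
        using S(2) that by blast
      show "\<exists>a'. a' \<in> ball (pt e) \<epsilon> \<inter> locus Z e \<and> (a' \<in> inside K \<longleftrightarrow> a \<in> inside K)" if "\<epsilon> > 0" for \<epsilon> a
        using S(3)[OF pt_opn that] J(5) by blast
    qed
  next
    case False
    have sep: "connected_component (- support (insert e Z)) a b" if "a \<in> locus Z e" "b \<in> locus Z e" for a b
    proof (rule bridge_nonseparating[OF assms uv False])
      have "connected_component (- support Z) (pt e) a" "connected_component (- support Z) (pt e) b"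
        using that unfolding locus_def by auto
      then show "connected_component (- support Z) a b"
        using connected_component_trans connected_component_sym by metis
    qed (use that in \<open>auto simp: locus_def\<close>)
    obtain \<delta> where \<delta>: "\<delta> > 0" "\<And>z. z \<in> ball (pt e) \<delta> \<Longrightarrow> z \<notin> img e \<Longrightarrow> z \<in> locus Z e"
      using locus_near[OF assms pt_opn] by metis
    have near: "\<exists>a'. a' \<in> ball (pt e) \<epsilon> \<inter> locus Z e" if "\<epsilon> > 0" for \<epsilon>
    proof -
      have "ball (pt e) (min \<epsilon> \<delta>) \<noteq> {}" using \<delta>(1) that by simp
      then have "\<not> ball (pt e) (min \<epsilon> \<delta>) \<subseteq> img e"
        using open_subset_arc_image_empty[OF arc[OF assms(1)] open_ball] unfolding img_def by blast
      then obtain a' where "a' \<in> ball (pt e) (min \<epsilon> \<delta>)" "a' \<notin> img e" by blast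
      then show ?thesis using \<delta>(2)[of a'] by auto
    qed
    show ?thesis by (rule that[of "{}"]) (use sep near in blast)+
  qed
qed

text \<open>The local form carries over between graphs that agree near \<open>pt e\<close>; the
  global one is accessible through the two classes of the locus.\<close>

lemma crossing_iff:
  assumes "e \<in> E" "Z \<subseteq> E - {e}" "face_const (insert e Z) \<xi>"
  shows "crossing (insert e Z) \<xi> e \<longleftrightarrow> (\<exists>a\<in>locus Z e. \<exists>b\<in>locus Z e. \<xi> a \<noteq> \<xi> b)"
proof
  assume c: "crossing (insert e Z) \<xi> e"
  obtain \<delta> where \<delta>: "\<delta> > 0" "\<And>z. z \<in> ball (pt e) \<delta> \<Longrightarrow> z \<notin> img e \<Longrightarrow> z \<in> locus Z e"
    using locus_near[OF assms(1,2) pt_opn] by metis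
  from c \<delta>(1) obtain a b where ab: "a \<in> ball (pt e) \<delta> - support (insert e Z)" "b \<in> ball (pt e) \<delta> - support (insert e Z)" "\<xi> a \<noteq> \<xi> b"
    unfolding crossing_def by blast
  then show "\<exists>a\<in>locus Z e. \<exists>b\<in>locus Z e. \<xi> a \<noteq> \<xi> b" using \<delta>(2) unfolding support_insert by blast
next
  assume "\<exists>a\<in>locus Z e. \<exists>b\<in>locus Z e. \<xi> a \<noteq> \<xi> b"
  then obtain a b where ab: "a \<in> locus Z e" "b \<in> locus Z e" "\<xi> a \<noteq> \<xi> b" by blast
  obtain A where A0: "\<forall>a\<in>locus Z e. \<forall>b\<in>locus Z e. (a \<in> A \<longleftrightarrow> b \<in> A) \<longrightarrow> connected_component (- support (insert e Z)) a b"
    "\<forall>\<epsilon>>0. \<forall>a\<in>locus Z e. \<exists>a'. a' \<in> ball (pt e) \<epsilon> \<inter> locus Z e \<and> (a' \<in> A \<longleftrightarrow> a \<in> A)"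
    by (rule two_sides[OF assms(1,2)])
  note A = A0[rule_format]
  show "crossing (insert e Z) \<xi> e"
    unfolding crossing_def
  proof (intro allI impI)
    fix \<epsilon> :: real assume \<epsilon>: "\<epsilon> > 0"
    obtain a' where a': "a' \<in> ball (pt e) \<epsilon>" "a' \<in> locus Z e" "a' \<in> A \<longleftrightarrow> a \<in> A" using A(2)[OF \<epsilon> ab(1)] by blast
    obtain b' where b': "b' \<in> ball (pt e) \<epsilon>" "b' \<in> locus Z e" "b' \<in> A \<longleftrightarrow> b \<in> A" using A(2)[OF \<epsilon> ab(2)] by blast
    have "\<xi> a' = \<xi> a" "\<xi> b' = \<xi> b"
      using face_constD[OF assms(3) A(1)[OF a'(2) ab(1) a'(3)]] face_constD[OF assms(3) A(1)[OF b'(2) ab(2) b'(3)]] .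
    then show "\<exists>a b. a \<in> ball (pt e) \<epsilon> - support (insert e Z) \<and> b \<in> ball (pt e) \<epsilon> - support (insert e Z) \<and> \<xi> a \<noteq> \<xi> b"
      using a' b' ab(3) locus_subset[of Z e] by blast
  qed
qed

section \<open>Edges crossed by a set of faces\<close>

lemma face_const_xor:
  "face_const W \<xi>1 \<Longrightarrow> face_const W \<xi>2 \<Longrightarrow> face_const W (\<lambda>z. \<xi>1 z \<noteq> \<xi>2 z)"
  unfolding face_const_def by blast

text \<open>This rests on the locus having at most two classes: with three, two predicates and their
  exclusive disjunction could all cross \<open>e\<close>.\<close>

lemma crossing_xor:
  assumes "e \<in> W" "W \<subseteq> E" and fc: "face_const W \<xi>1" "face_const W \<xi>2"
  shows "crossing W (\<lambda>z. \<xi>1 z \<noteq> \<xi>2 z) e \<longleftrightarrow> crossing W \<xi>1 e \<noteq> crossing W \<xi>2 e"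
proof -
  define Z where "Z = W - {e}"
  have W: "W = insert e Z" and Z: "Z \<subseteq> E - {e}" and e: "e \<in> E" unfolding Z_def using assms by auto
  obtain A where A0: "\<forall>a\<in>locus Z e. \<forall>b\<in>locus Z e. (a \<in> A \<longleftrightarrow> b \<in> A) \<longrightarrow> connected_component (- support (insert e Z)) a b"
    "\<forall>\<epsilon>>0. \<forall>a\<in>locus Z e. \<exists>a'. a' \<in> ball (pt e) \<epsilon> \<inter> locus Z e \<and> (a' \<in> A \<longleftrightarrow> a \<in> A)"
    by (rule two_sides[OF e Z])
  note A = A0(1)[rule_format]
  have side: "\<xi> a = \<xi> b" if "face_const W \<xi>" "a \<in> locus Z e" "b \<in> locus Z e" "a \<in> A \<longleftrightarrow> b \<in> A" for \<xi> a b
    using face_constD[OF that(1)] A[OF that(2-4)] unfolding W by blast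
  have iff: "crossing W \<xi> e \<longleftrightarrow> (\<exists>a\<in>locus Z e. \<exists>b\<in>locus Z e. \<xi> a \<noteq> \<xi> b)" if "face_const W \<xi>" for \<xi>
    using crossing_iff[OF e Z] that unfolding W by blast
  note fx = face_const_xor[OF fc]
  show ?thesis
  proof (cases "\<exists>a\<in>locus Z e. \<exists>b\<in>locus Z e. (a \<in> A) \<noteq> (b \<in> A)")
    case True
    then obtain a b where ab: "a \<in> locus Z e" "b \<in> locus Z e" "(a \<in> A) \<noteq> (b \<in> A)" by blast
    have "crossing W \<xi> e \<longleftrightarrow> \<xi> a \<noteq> \<xi> b" if f: "face_const W \<xi>" for \<xi>
    proof -
      have "\<xi> x = \<xi> a \<or> \<xi> x = \<xi> b" if "x \<in> locus Z e" for x
        using side[OF f that ab(1)] side[OF f that ab(2)] ab(3) by blast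
      then show ?thesis unfolding iff[OF f] using ab by metis
    qed
    then show ?thesis using fc fx by blast
  next
    case False
    then have "\<not> crossing W \<xi> e" if "face_const W \<xi>" for \<xi> unfolding iff[OF that] using side[OF that] by blast
    then show ?thesis using fc fx by blast
  qed
qed

lemma crossing_cong:
  assumes "\<delta> > 0"
    and "\<And>z. z \<in> ball (pt e) \<delta> \<Longrightarrow> z \<in> support W \<longleftrightarrow> z \<in> support W'"
    and "\<And>z. z \<in> ball (pt e) \<delta> \<Longrightarrow> z \<notin> support W \<Longrightarrow> \<xi> z = \<xi>' z"
  shows "crossing W \<xi> e \<longleftrightarrow> crossing W' \<xi>' e"
proof -
  have *: "crossing W' \<xi>' e"
    if c: "crossing W \<xi> e" and 1: "\<And>z. z \<in> ball (pt e) \<delta> \<Longrightarrow> z \<in> support W \<longleftrightarrow> z \<in> support W'"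
      and 2: "\<And>z. z \<in> ball (pt e) \<delta> \<Longrightarrow> z \<notin> support W \<Longrightarrow> \<xi> z = \<xi>' z" for W W' \<xi> \<xi>'
    unfolding crossing_def
  proof (intro allI impI)
    fix \<epsilon> :: real assume "\<epsilon> > 0"
    then have "min \<epsilon> \<delta> > 0" using assms(1) by simp
    then obtain a b where ab: "a \<in> ball (pt e) (min \<epsilon> \<delta>) - support W" "b \<in> ball (pt e) (min \<epsilon> \<delta>) - support W" "\<xi> a \<noteq> \<xi> b"
      using c unfolding crossing_def by blast
    then have "a \<in> ball (pt e) \<epsilon>" "b \<in> ball (pt e) \<epsilon>" "a \<in> ball (pt e) \<delta>" "b \<in> ball (pt e) \<delta>" by auto
    then show "\<exists>a b. a \<in> ball (pt e) \<epsilon> - support W' \<and> b \<in> ball (pt e) \<epsilon> - support W' \<and> \<xi>' a \<noteq> \<xi>' b"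
      using ab 1 2 by blast
  qed
  show ?thesis using *[of W \<xi> W' \<xi>'] *[of W' \<xi>' W \<xi>] assms(2,3) by blast
qed

lemma cycle_crossing:
  assumes e: "e \<in> E" and P: "insert e P \<subseteq> W" "W \<subseteq> E" "cycle_through e P" and K: "K = \<Union>(img ` insert e P)"
  shows "face_const W (\<lambda>z. z \<in> inside K)"
    and "e' \<in> W \<Longrightarrow> crossing W (\<lambda>z. z \<in> inside K) e' \<longleftrightarrow> e' \<in> insert e P"
proof -
  note J = cycle_throughD[OF P(3) K]
  have KW: "K \<subseteq> support W" unfolding K support_def using P(1) by auto
  have same: "a \<in> inside K \<longleftrightarrow> b \<in> inside K" if "connected_component (- K) a b" for a b
    using inside_same_component[of K a b] inside_same_component[of K b a] that connected_component_sym by metis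
  show "face_const W (\<lambda>z. z \<in> inside K)"
    unfolding face_const_def
  proof (intro allI impI)
    fix a b assume "connected_component (- support W) a b"
    then have "connected_component (- K) a b" by (rule connected_component_of_subset) (use KW in blast)
    then show "a \<in> inside K \<longleftrightarrow> b \<in> inside K" by (rule same)
  qed
  assume e': "e' \<in> W"
  then have e'E: "e' \<in> E" using P(2) by auto
  show "crossing W (\<lambda>z. z \<in> inside K) e' \<longleftrightarrow> e' \<in> insert e P"
  proof (cases "e' \<in> insert e P")
    case True
    have "W - {e'} \<subseteq> E - {e'}" using P(2) by blast
    then obtain \<delta> where \<delta>: "\<delta> > 0" "\<And>z. z \<in> ball (pt e') \<delta> \<Longrightarrow> z \<notin> support (W - {e'})"
      using locus_near[OF e'E _ pt_opn] by metis
    have W: "support W = support (W - {e'}) \<union> img e'" using support_insert[of e' "W - {e'}"] e' by (simp add: insert_absorb)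
    have eK: "img e' \<subseteq> K" unfolding K using True by blast
    have "pt e' \<in> K" using pt_img[OF e'E] eK by blast
    then have cl: "pt e' \<in> closure (inside K)" "pt e' \<in> closure (outside K)" using J(7,8) unfolding frontier_def by blast+
    have "crossing W (\<lambda>z. z \<in> inside K) e'" unfolding crossing_def
    proof (intro allI impI)
      fix \<epsilon> :: real assume "\<epsilon> > 0"
      then have "min \<epsilon> \<delta> > 0" using \<delta>(1) by simp
      then obtain a b where ab: "a \<in> inside K" "dist a (pt e') < min \<epsilon> \<delta>" "b \<in> outside K" "dist b (pt e') < min \<epsilon> \<delta>"
        using cl unfolding closure_approachable by blast
      have K': "a \<notin> K" "b \<notin> K" using ab(1,3) J(6) by blast+
      have B: "a \<in> ball (pt e') \<epsilon>" "b \<in> ball (pt e') \<epsilon>" "a \<in> ball (pt e') \<delta>" "b \<in> ball (pt e') \<delta>" using ab(2,4) by (simp_all add: dist_commute)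
      have "a \<notin> support W" "b \<notin> support W" unfolding W using \<delta>(2)[OF B(3)] \<delta>(2)[OF B(4)] K' eK by blast+
      then show "\<exists>a b. a \<in> ball (pt e') \<epsilon> - support W \<and> b \<in> ball (pt e') \<epsilon> - support W \<and> (a \<in> inside K) \<noteq> (b \<in> inside K)"
        using B ab(1,3) J(5) by blast
    qed
    then show ?thesis using True by blast
  next
    case False
    have "pt e' \<notin> img x" if "x \<in> insert e P" for x
      by (rule pt_notin_img[OF e'E]) (use that False P in auto)
    then have "pt e' \<in> - K" unfolding K by blast
    moreover have "open (- K)" using J(1,3,6) by (metis open_Un)
    ultimately obtain \<epsilon> where \<epsilon>: "\<epsilon> > 0" "ball (pt e') \<epsilon> \<subseteq> - K" using open_contains_ball by blast
    have "a \<in> inside K \<longleftrightarrow> b \<in> inside K" if "a \<in> ball (pt e') \<epsilon>" "b \<in> ball (pt e') \<epsilon>" for a b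
      by (rule same) (use that \<epsilon>(2) connected_ball in \<open>auto simp: connected_component_def\<close>)
    then have "\<not> crossing W (\<lambda>z. z \<in> inside K) e'" unfolding crossing_def using \<epsilon>(1) by blast
    then show ?thesis using False by blast
  qed
qed

lemma crossing_insert:
  assumes "e \<in> E" "Z \<subseteq> E - {e}" "e' \<in> Z" and eq: "\<And>z. z \<notin> support (insert e Z) \<Longrightarrow> \<xi> z = \<xi>' z"
  shows "crossing (insert e Z) \<xi> e' \<longleftrightarrow> crossing Z \<xi>' e'"
proof -
  have e': "e' \<in> E" "e \<noteq> e'" using assms(2,3) by auto
  have "pt e' \<in> - img e" using pt_notin_img[OF e'(1) assms(1) e'(2)] by blast
  moreover have "open (- img e)" using compact_img[OF assms(1)] by (intro open_Compl compact_imp_closed)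
  ultimately obtain \<delta> where \<delta>: "\<delta> > 0" "ball (pt e') \<delta> \<subseteq> - img e" using open_contains_ball by blast
  show ?thesis by (rule crossing_cong[OF \<delta>(1)]) (use \<delta>(2) eq support_insert[of e Z] in blast)+
qed

text \<open>A predicate that does not cross \<open>e\<close> is constant on the locus, so it
  descends to the graph without \<open>e\<close>: the face that swallows \<open>e\<close> receives
  the common value, and the other faces are disjoint from \<open>e\<close>.\<close>

lemma glue_faces:
  assumes "e \<in> E" "Z \<subseteq> E - {e}" "face_const (insert e Z) \<xi>" "\<not> crossing (insert e Z) \<xi> e"
  obtains \<xi>' where "face_const Z \<xi>'" "\<forall>z. z \<notin> support (insert e Z) \<longrightarrow> \<xi> z = \<xi>' z"
proof -
  define H where "H = connected_component_set (- support Z) (pt e)"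
  define \<xi>' where "\<xi>' z = (if z \<in> H then (\<exists>y\<in>locus Z e. \<xi> y) else \<xi> z)" for z
  have L: "locus Z e = H - img e" unfolding locus_def H_def ..
  have const: "\<xi> a = \<xi> b" if "a \<in> locus Z e" "b \<in> locus Z e" for a b
    using assms(4) that unfolding crossing_iff[OF assms(1-3)] by blast
  have ext: "\<xi> z = \<xi>' z" if z: "z \<notin> support (insert e Z)" for z
  proof (cases "z \<in> H")
    case True
    then have "z \<in> locus Z e" using z unfolding L support_insert by blast
    then show ?thesis unfolding \<xi>'_def using True const by (metis (full_types))
  qed (simp add: \<xi>'_def)
  have "face_const Z \<xi>'"
    unfolding face_const_def
  proof (intro allI impI)
    fix a b assume ab: "connected_component (- support Z) a b"
    show "\<xi>' a = \<xi>' b"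
    proof (cases "a \<in> H")
      case True
      then have "b \<in> H" using connected_component_trans[OF _ ab] unfolding H_def by simp
      then show ?thesis using True unfolding \<xi>'_def by simp
    next
      case False
      then have b: "b \<notin> H"
        using connected_component_trans[OF _ connected_component_sym[OF ab]] unfolding H_def by auto
      define A where "A = connected_component_set (- support Z) a"
      have A: "connected A" "A \<subseteq> - support Z"
        unfolding A_def by (rule connected_connected_component connected_component_subset)+
      have A2: "a \<in> A" "b \<in> A"
        using ab connected_component_in(1)[OF ab] unfolding A_def by (simp_all add: connected_component_refl)
      have "A \<inter> H = {}"
      proof (rule ccontr)
        assume "A \<inter> H \<noteq> {}"
        then obtain y where y: "connected_component (- support Z) a y" "connected_component (- support Z) (pt e) y"
          unfolding A_def H_def by auto
        have "connected_component (- support Z) (pt e) a"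
          by (rule connected_component_trans[OF y(2) connected_component_sym[OF y(1)]])
        then show False using False unfolding H_def by simp
      qed
      moreover have "img e \<subseteq> H \<union> support Z"
        using img_eq[OF assms(1)] opn_component[OF assms(1,2)] h(1)[OF assms(1)] unfolding H_def support_def by blast
      ultimately have "A \<subseteq> - support (insert e Z)" using A(2) unfolding support_insert by blast
      then have "connected_component (- support (insert e Z)) a b" using A(1) A2 unfolding connected_component_def by blast
      then have "\<xi> a = \<xi> b" by (rule face_constD[OF assms(3)])
      then show ?thesis using False b unfolding \<xi>'_def by simp
    qed
  qed
  then show ?thesis using that ext by blast
qed

text \<open>Evenness and connectedness of the dual are proved together by deleting an edge. If
  \<open>e\<close> is not crossed, \<open>glue_faces\<close> removes it. If it is crossed, it is no
  bridge, and adding the inside of a cycle through \<open>e\<close> leads back to the first case,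
  changing the crossed edges by an even set.\<close>

lemma crossing_even:
  assumes "Z \<subseteq> E"
  shows "\<forall>\<xi>. face_const Z \<xi> \<longrightarrow> (\<forall>x. even (deg h {e \<in> Z. crossing Z \<xi> e} x)) \<and>
    ((\<forall>e\<in>Z. \<not> crossing Z \<xi> e) \<longrightarrow> (\<forall>a b. a \<notin> support Z \<longrightarrow> b \<notin> support Z \<longrightarrow> \<xi> a = \<xi> b))"
proof -
  have "finite Z" using assms finE finite_subset by blast
  then show ?thesis using assms
  proof (induction Z rule: finite_induct)
    case empty
    have "connected (- V)"
      using finV by (intro path_connected_imp_connected path_connected_complement_countable countable_finite) auto
    then have c: "connected_component (- support {}) a b" if "a \<notin> support {}" "b \<notin> support {}" for a b
      using that unfolding connected_component_def support_def by auto
    have "{e \<in> {}. crossing {} \<xi> e} = {}" for \<xi> by blast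
    then show ?case using face_constD[OF _ c] by simp
  next
    case (insert e Z)
    have e: "e \<in> E" and Z: "Z \<subseteq> E - {e}" and ZE: "insert e Z \<subseteq> E" using insert.hyps insert.prems by auto
    note IH = insert.IH[OF order_trans[OF Z Diff_subset], rule_format]
    have step: "(\<forall>x. even (deg h {e' \<in> insert e Z. crossing (insert e Z) \<xi> e'} x)) \<and>
      ((\<forall>e'\<in>insert e Z. \<not> crossing (insert e Z) \<xi> e') \<longrightarrow>
        (\<forall>a b. a \<notin> support (insert e Z) \<longrightarrow> b \<notin> support (insert e Z) \<longrightarrow> \<xi> a = \<xi> b))"
      if f: "face_const (insert e Z) \<xi>" and n: "\<not> crossing (insert e Z) \<xi> e" for \<xi>
    proof -
      obtain \<xi>' where \<xi>': "face_const Z \<xi>'" and eq0: "\<forall>z. z \<notin> support (insert e Z) \<longrightarrow> \<xi> z = \<xi>' z"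
        by (rule glue_faces[OF e Z f n])
      note eq = eq0[rule_format]
      have c: "crossing (insert e Z) \<xi> e' \<longleftrightarrow> crossing Z \<xi>' e'" if "e' \<in> Z" for e'
        by (rule crossing_insert[OF e Z that eq])
      have set: "{e' \<in> insert e Z. crossing (insert e Z) \<xi> e'} = {e' \<in> Z. crossing Z \<xi>' e'}"
        using c n by blast
      have "\<xi> a = \<xi> b" if "\<forall>e'\<in>insert e Z. \<not> crossing (insert e Z) \<xi> e'"
        and ab: "a \<notin> support (insert e Z)" "b \<notin> support (insert e Z)" for a b
      proof -
        have 1: "\<forall>e'\<in>Z. \<not> crossing Z \<xi>' e'" using c that(1) by blast
        have "a \<notin> support Z" "b \<notin> support Z" using ab unfolding support_insert by blast+
        then have "\<xi>' a = \<xi>' b" using IH[OF \<xi>'] 1 by blast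
        then show ?thesis using eq ab by blast
      qed
      then show ?thesis unfolding set using IH[OF \<xi>'] by blast
    qed
    show ?case
    proof (intro allI impI)
      fix \<xi> assume f: "face_const (insert e Z) \<xi>"
      show "(\<forall>x. even (deg h {e' \<in> insert e Z. crossing (insert e Z) \<xi> e'} x)) \<and>
      ((\<forall>e'\<in>insert e Z. \<not> crossing (insert e Z) \<xi> e') \<longrightarrow>
        (\<forall>a b. a \<notin> support (insert e Z) \<longrightarrow> b \<notin> support (insert e Z) \<longrightarrow> \<xi> a = \<xi> b))"
      proof (cases "crossing (insert e Z) \<xi> e")
        case False
        then show ?thesis by (rule step[OF f])
      next
        case True
        obtain u v where uv: "h e = {u, v}" using h(2)[OF e] by (meson card_2_iff)
        have reach: "(u, v) \<in> (adj h Z)\<^sup>*"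
        proof (rule ccontr)
          assume no: "(u, v) \<notin> (adj h Z)\<^sup>*"
          obtain a b where ab: "a \<in> locus Z e" "b \<in> locus Z e" "\<xi> a \<noteq> \<xi> b"
            using True unfolding crossing_iff[OF e Z f] by blast
          have "connected_component (- support (insert e Z)) a b"
          proof (rule bridge_nonseparating[OF e Z uv no])
            have "connected_component (- support Z) (pt e) a" "connected_component (- support Z) (pt e) b"
              using ab unfolding locus_def by auto
            then show "connected_component (- support Z) a b"
              by (meson connected_component_trans connected_component_sym)
            show "a \<notin> img e" "b \<notin> img e" using ab unfolding locus_def by blast+
          qed
          then show False using face_constD[OF f] ab(3) by blast
        qed
        obtain P where P: "P \<subseteq> Z" "cycle_through e P" by (rule cycle_through_exists[OF e Z uv reach])
        define K where "K = \<Union>(img ` insert e P)"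
        have PZ: "insert e P \<subseteq> insert e Z" using P(1) by blast
        note C = cycle_crossing[OF e PZ ZE P(2) K_def]
        define \<xi>2 where "\<xi>2 = (\<lambda>z. \<xi> z \<noteq> (z \<in> inside K))"
        have f2: "face_const (insert e Z) \<xi>2" unfolding \<xi>2_def by (rule face_const_xor[OF f C(1)])
        have c2: "crossing (insert e Z) \<xi>2 e' \<longleftrightarrow> crossing (insert e Z) \<xi> e' \<noteq> (e' \<in> insert e P)" if "e' \<in> insert e Z" for e'
          unfolding \<xi>2_def crossing_xor[OF that ZE f C(1)] C(2)[OF that] ..
        have "\<not> crossing (insert e Z) \<xi>2 e" using c2[of e] True by blast
        then have ev2: "even (deg h {e' \<in> insert e Z. crossing (insert e Z) \<xi>2 e'} x)" for x using step[OF f2] by blast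
        have evP: "even (deg h (insert e P) x)" for x using P(2) unfolding cycle_through_def by blast
        have set: "{e' \<in> insert e Z. crossing (insert e Z) \<xi> e'} =
          sym_diff {e' \<in> insert e Z. crossing (insert e Z) \<xi>2 e'} (insert e P)"
          using c2 PZ by blast
        have fin: "finite {e' \<in> insert e Z. crossing (insert e Z) \<xi>2 e'}" "finite (insert e P)"
          using insert.hyps(1) finite_subset[OF PZ] by simp_all
        have "even (deg h {e' \<in> insert e Z. crossing (insert e Z) \<xi> e'} x)" for x
          using odd_deg_sym_diff[OF fin, of h x] ev2[of x] evP[of x] unfolding set[symmetric] by blast
        then show ?thesis using True by blast
      qed
    qed
  qed
qed

text \<open>If \<open>e\<close> were a bridge of \<open>Z\<close>, one of its sides would have
  \<open>e\<close> as its only boundary edge, against the even degrees.\<close>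

lemma even_reach:
  assumes "Z \<subseteq> E" "\<And>x. x \<in> V \<Longrightarrow> even (deg h Z x)" "e \<in> Z" "h e = {u, v}"
  shows "(u, v) \<in> (adj h (Z - {e}))\<^sup>*"
proof (rule ccontr)
  assume no: "(u, v) \<notin> (adj h (Z - {e}))\<^sup>*"
  define R where "R = {w. (u, w) \<in> (adj h (Z - {e}))\<^sup>*}"
  have hZ: "\<And>x. x \<in> Z \<Longrightarrow> card (h x) = 2" using h(2) assms(1) by blast
  have uV: "u \<in> V" using h(1)[of e] assms by auto
  have "w \<in> V" if "(u, w) \<in> (adj h (Z - {e}))\<^sup>*" for w
    using that by (induction rule: rtrancl_induct) (use uV h(1) assms(1) in \<open>auto simp: adj_def\<close>)
  then have RV: "R \<subseteq> V" unfolding R_def by blast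
  have uv: "u \<noteq> v" using hZ[OF assms(3)] assms(4) by auto
  have "card (h e \<inter> R) = 1" unfolding assms(4) card_2_Int_eq_1[OF uv] R_def using no by simp
  moreover have "bd h (Z - {e}) R = {}" unfolding R_def by (rule bd_reach_empty) (use hZ in blast)
  ultimately have "bd h Z R = {e}" using assms(3) unfolding bd_def by blast
  moreover have "odd (card (bd h Z R)) \<longleftrightarrow> odd (card {x \<in> R. odd (deg h Z x)})"
    by (rule handshake[OF finite_subset[OF assms(1) finE] finite_subset[OF RV finV] hZ])
  moreover have "{x \<in> R. odd (deg h Z x)} = {}" using assms(2) RV by blast
  ultimately show False by simp
qed

text \<open>An even set contains a cycle through each of its edges; cycles are split off one after
  the other, and their insides are added modulo 2.\<close>

lemma even_is_crossing:
  assumes "Z \<subseteq> E" "\<And>x. x \<in> V \<Longrightarrow> even (deg h Z x)"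
  shows "\<exists>\<xi>. face_const E \<xi> \<and> Z = {e \<in> E. crossing E \<xi> e}"
  using assms
proof (induction "card Z" arbitrary: Z rule: less_induct)
  case less
  have finZ: "finite Z" using less.prems(1) finE finite_subset by blast
  show ?case
  proof (cases "Z = {}")
    case True
    have "\<not> crossing E (\<lambda>_. False) e" for e unfolding crossing_def by (auto intro: exI[of _ 1])
    then show ?thesis using True by (intro exI[of _ "\<lambda>_. False"]) (auto simp: face_const_def)
  next
    case False
    then obtain e where e: "e \<in> Z" by blast
    then have eE: "e \<in> E" using less.prems(1) by blast
    obtain u v where uv: "h e = {u, v}" using h(2)[OF eE] by (meson card_2_iff)
    have Ze: "Z - {e} \<subseteq> E - {e}" using less.prems(1) by blast
    obtain P where P: "P \<subseteq> Z - {e}" "cycle_through e P"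
      by (rule cycle_through_exists[OF eE Ze uv even_reach[OF less.prems e uv]])
    define K where "K = \<Union>(img ` insert e P)"
    have PE: "insert e P \<subseteq> E" and PZ: "insert e P \<subseteq> Z" using P(1) e less.prems(1) by blast+
    note C = cycle_crossing[OF eE PE order_refl P(2) K_def]
    have evP: "even (deg h (insert e P) x)" for x using P(2) unfolding cycle_through_def by blast
    have eq: "Z - insert e P = sym_diff Z (insert e P)" using PZ by blast
    have "even (deg h (Z - insert e P) x)" if "x \<in> V" for x
      using odd_deg_sym_diff[OF finZ finite_subset[OF PZ finZ], of h x] less.prems(2)[OF that] evP[of x]
      unfolding eq[symmetric] by blast
    moreover have "card (Z - insert e P) < card Z" using e finZ by (intro psubset_card_mono) auto
    moreover have "Z - insert e P \<subseteq> E" using less.prems(1) by blast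
    ultimately obtain \<xi> where \<xi>: "face_const E \<xi>" "Z - insert e P = {e' \<in> E. crossing E \<xi> e'}" using less.hyps by blast
    have "crossing E (\<lambda>z. \<xi> z \<noteq> (z \<in> inside K)) e' \<longleftrightarrow> crossing E \<xi> e' \<noteq> (e' \<in> insert e P)" if "e' \<in> E" for e'
      unfolding crossing_xor[OF that order_refl \<xi>(1) C(1)] C(2)[OF that] ..
    then have "Z = {e' \<in> E. crossing E (\<lambda>z. \<xi> z \<noteq> (z \<in> inside K)) e'}" using \<xi>(2) PZ PE by blast
    then show ?thesis using face_const_xor[OF \<xi>(1) C(1)] by blast
  qed
qed

section \<open>Faces and the dual of a bridgeless plane graph\<close>

definition face_set :: "complex set set" where "face_set = components (- support E)"
definition dual_ends :: "'e \<Rightarrow> complex set set" where "dual_ends e = {H \<in> face_set. opn e \<subseteq> frontier H}"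

lemma face_eq: "H \<in> face_set \<Longrightarrow> a \<in> H \<Longrightarrow> H = connected_component_set (- support E) a"
  unfolding face_set_def by (metis componentsE connected_component_eq)

text \<open>\<open>H1\<close> and \<open>H2\<close> contain the inner and the outer part of the
  locus. Any face with \<open>e\<close> on its boundary comes close to \<open>pt e\<close>, hence
  enters the locus and is one of them.\<close>

lemma dual_ends_pair:
  assumes "e \<in> E" "h e = {u, v}" "(u, v) \<in> (adj h (E - {e}))\<^sup>*"
  obtains H1 H2 where "H1 \<in> face_set" "H2 \<in> face_set" "H1 \<noteq> H2" "dual_ends e = {H1, H2}"
    "\<forall>\<xi>. face_const E \<xi> \<longrightarrow> (crossing E \<xi> e \<longleftrightarrow> (\<forall>a\<in>H1. \<forall>b\<in>H2. \<xi> a \<noteq> \<xi> b))"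
proof -
  define Z where "Z = E - {e}"
  have Z: "Z \<subseteq> E - {e}" and EZ: "insert e Z = E" unfolding Z_def using assms(1) by auto
  obtain P where P: "P \<subseteq> Z" "cycle_through e P"
    by (rule cycle_through_exists[OF assms(1) Z assms(2)]) (use assms(3) Z_def in auto)
  define K where "K = \<Union>(img ` insert e P)"
  note S = cycle_locus_sides[OF assms(1) Z P K_def, unfolded EZ] and J = cycle_throughD[OF P(2) K_def]
  note L = locus_subset[of Z e, unfolded EZ]
  obtain a b where ab: "a \<in> locus Z e" "a \<in> inside K" "b \<in> locus Z e" "b \<in> outside K"
    using S(3)[OF pt_opn, of 1] by auto
  define H1 where "H1 = connected_component_set (- support E) a"
  define H2 where "H2 = connected_component_set (- support E) b"
  have HF: "H1 \<in> face_set" "H2 \<in> face_set"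
    unfolding H1_def H2_def face_set_def using L ab by (auto intro: componentsI)
  have mem: "a \<in> H1" "b \<in> H2" unfolding H1_def H2_def using L ab by auto
  have in1: "z \<in> H1" if "z \<in> locus Z e" "z \<in> inside K" for z
    unfolding H1_def using S(2)[OF ab(1) that(1)] ab(2) that(2) by blast
  have in2: "z \<in> H2" if "z \<in> locus Z e" "z \<in> outside K" for z
    unfolding H2_def using S(2)[OF ab(3) that(1)] ab(4) that(2) J(5) by blast
  have KE: "face_const E (\<lambda>z. z \<in> inside K)"
    by (rule cycle_crossing(1)[OF assms(1) _ order_refl P(2) K_def]) (use P(1) Z assms(1) in auto)
  have ne: "H1 \<noteq> H2"
  proof
    assume "H1 = H2"
    then have "connected_component (- support E) a b" using mem unfolding H1_def by auto
    then have "a \<in> inside K \<longleftrightarrow> b \<in> inside K" by (rule face_constD[OF KE])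
    then show False using ab J(5) by blast
  qed
  have near: "opn e \<subseteq> frontier H" if "H \<in> face_set" "\<And>q \<epsilon>. q \<in> opn e \<Longrightarrow> \<epsilon> > 0 \<Longrightarrow> \<exists>z. z \<in> ball q \<epsilon> \<inter> H" for H
  proof
    fix q assume q: "q \<in> opn e"
    have "q \<in> closure H" unfolding closure_approachable using that(2)[OF q] by (auto simp: dist_commute)
    moreover have "q \<in> support E" using q img_eq[OF assms(1)] assms(1) unfolding support_def by blast
    then have "q \<notin> H" using that(1) in_components_subset unfolding face_set_def by blast
    ultimately show "q \<in> frontier H" unfolding frontier_def using interior_subset by blast
  qed
  have "H = H1 \<or> H = H2" if H: "H \<in> face_set" "opn e \<subseteq> frontier H" for H
  proof -
    obtain \<delta> where \<delta>: "\<delta> > 0" "\<And>z. z \<in> ball (pt e) \<delta> \<Longrightarrow> z \<notin> img e \<Longrightarrow> z \<in> locus Z e"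
      using locus_near[OF assms(1) Z pt_opn] by metis
    have "pt e \<in> closure H" using H(2) pt_opn[of e] unfolding frontier_def by blast
    then obtain z where z: "z \<in> H" "dist z (pt e) < \<delta>" using \<delta>(1) unfolding closure_approachable by blast
    have "z \<notin> support E" using z(1) H(1) in_components_subset unfolding face_set_def by blast
    then have "z \<notin> img e" using assms(1) unfolding support_def by blast
    then have zl: "z \<in> locus Z e" using \<delta>(2) z(2) by (simp add: dist_commute)
    then have "z \<in> H1 \<or> z \<in> H2" using S(1) in1 in2 by blast
    then show ?thesis using face_eq[OF H(1) z(1)] face_eq[OF HF(1)] face_eq[OF HF(2)] by metis
  qed
  moreover have "opn e \<subseteq> frontier H1"
    by (rule near[OF HF(1)]) (use S(3) in1 in blast)
  moreover have "opn e \<subseteq> frontier H2"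
    by (rule near[OF HF(2)]) (use S(3) in2 in blast)
  ultimately have de: "dual_ends e = {H1, H2}" unfolding dual_ends_def using HF by blast
  have "crossing E \<xi> e \<longleftrightarrow> (\<forall>a\<in>H1. \<forall>b\<in>H2. \<xi> a \<noteq> \<xi> b)" if f: "face_const E \<xi>" for \<xi>
  proof -
    have c1: "\<xi> x = \<xi> a" if "x \<in> H1" for x using that face_constD[OF f] unfolding H1_def by blast
    have c2: "\<xi> x = \<xi> b" if "x \<in> H2" for x using that face_constD[OF f] unfolding H2_def by blast
    have "x \<in> H1 \<or> x \<in> H2" if "x \<in> locus Z e" for x using that S(1) in1 in2 by blast
    then have 1: "\<xi> x = \<xi> a \<or> \<xi> x = \<xi> b" if "x \<in> locus Z e" for x using c1 c2 that by blast
    have "crossing E \<xi> e \<longleftrightarrow> (\<exists>a\<in>locus Z e. \<exists>b\<in>locus Z e. \<xi> a \<noteq> \<xi> b)"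
      using crossing_iff[OF assms(1) Z, unfolded EZ, OF f] .
    also have "\<dots> \<longleftrightarrow> \<xi> a \<noteq> \<xi> b"
    proof
      assume "\<exists>a\<in>locus Z e. \<exists>b\<in>locus Z e. \<xi> a \<noteq> \<xi> b"
      then obtain x y where "x \<in> locus Z e" "y \<in> locus Z e" "\<xi> x \<noteq> \<xi> y" by blast
      then show "\<xi> a \<noteq> \<xi> b" using 1[of x] 1[of y] by metis
    next
      assume "\<xi> a \<noteq> \<xi> b" then show "\<exists>a\<in>locus Z e. \<exists>b\<in>locus Z e. \<xi> a \<noteq> \<xi> b" using ab by blast
    qed
    also have "\<dots> \<longleftrightarrow> (\<forall>a\<in>H1. \<forall>b\<in>H2. \<xi> a \<noteq> \<xi> b)" using c1 c2 mem by metis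
    finally show ?thesis .
  qed
  then show ?thesis using that[OF HF ne de] by blast
qed

definition face_indicator :: "complex set set \<Rightarrow> complex \<Rightarrow> bool" where
  "face_indicator S z \<longleftrightarrow> z \<in> \<Union>S"

context
  assumes bridgeless: "\<And>e u v. e \<in> E \<Longrightarrow> h e = {u, v} \<Longrightarrow> (u, v) \<in> (adj h (E - {e}))\<^sup>*"
begin

lemma dual_ends_card: "e \<in> E \<Longrightarrow> dual_ends e \<subseteq> face_set \<and> card (dual_ends e) = 2"
proof -
  assume e: "e \<in> E"
  obtain u v where uv: "h e = {u, v}" using h(2)[OF e] by (meson card_2_iff)
  obtain H1 H2 where "H1 \<in> face_set" "H2 \<in> face_set" "H1 \<noteq> H2" "dual_ends e = {H1, H2}"
    by (rule dual_ends_pair[OF e uv bridgeless[OF e uv]])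
  then show ?thesis by simp
qed

text \<open>The dictionary between topology and the dual: dual cuts are the sets of crossed
  edges.\<close>

lemma bd_dual:
  assumes f: "face_const E \<xi>" and S: "S = {H \<in> face_set. \<exists>z\<in>H. \<xi> z}"
  shows "bd dual_ends E S = {e \<in> E. crossing E \<xi> e}"
proof -
  have "card (dual_ends e \<inter> S) = 1 \<longleftrightarrow> crossing E \<xi> e" if e: "e \<in> E" for e
  proof -
    obtain u v where uv: "h e = {u, v}" using h(2)[OF e] by (meson card_2_iff)
    obtain H1 H2 where H: "H1 \<in> face_set" "H2 \<in> face_set" "H1 \<noteq> H2" "dual_ends e = {H1, H2}"
      "\<forall>\<xi>. face_const E \<xi> \<longrightarrow> (crossing E \<xi> e \<longleftrightarrow> (\<forall>a\<in>H1. \<forall>b\<in>H2. \<xi> a \<noteq> \<xi> b))"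
      by (rule dual_ends_pair[OF e uv bridgeless[OF e uv]])
    obtain a b where ab: "a \<in> H1" "b \<in> H2" using H(1,2) in_components_nonempty unfolding face_set_def by blast
    have const: "\<xi> x = \<xi> y" if "x \<in> H" "y \<in> H" "H \<in> face_set" for x y H
      using face_eq[OF that(3,1)] that(2) face_constD[OF f] by blast
    have "H1 \<in> S \<longleftrightarrow> \<xi> a" "H2 \<in> S \<longleftrightarrow> \<xi> b" using S H(1,2) ab const by blast+
    moreover have "crossing E \<xi> e \<longleftrightarrow> \<xi> a \<noteq> \<xi> b" using H(5) f ab const[OF _ _ H(1)] const[OF _ _ H(2)] by metis
    ultimately show ?thesis unfolding H(4) card_2_Int_eq_1[OF H(3)] by blast
  qed
  then show ?thesis unfolding bd_def by blast
qed

lemma face_indicator: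
  assumes "S \<subseteq> face_set"
  shows "face_const E (face_indicator S)" "S = {H \<in> face_set. \<exists>z\<in>H. face_indicator S z}"
proof -
  have iff: "face_indicator S z \<longleftrightarrow> connected_component_set (- support E) z \<in> S" if "z \<notin> support E" for z
  proof
    assume "face_indicator S z"
    then obtain H where H: "z \<in> H" "H \<in> S" unfolding face_indicator_def by blast
    then have "H \<in> face_set" using assms by blast
    then show "connected_component_set (- support E) z \<in> S" using face_eq[OF _ H(1)] H(2) by simp
  next
    assume "connected_component_set (- support E) z \<in> S"
    moreover have "z \<in> connected_component_set (- support E) z" using that by (simp add: connected_component_refl)
    ultimately show "face_indicator S z" unfolding face_indicator_def by blast
  qed
  show "face_const E (face_indicator S)"
    unfolding face_const_def
  proof (intro allI impI)
    fix a b assume c: "connected_component (- support E) a b"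
    then have "a \<notin> support E" "b \<notin> support E" using connected_component_in by blast+
    moreover have "connected_component_set (- support E) a = connected_component_set (- support E) b"
      using connected_component_eq[of b "- support E" a] c by simp
    ultimately show "face_indicator S a = face_indicator S b" using iff[of a] iff[of b] by simp
  qed
  show "S = {H \<in> face_set. \<exists>z\<in>H. face_indicator S z}"
  proof (intro equalityI subsetI)
    fix H assume "H \<in> S"
    moreover from this have "H \<in> face_set" using assms by blast
    moreover from this obtain z where "z \<in> H" using in_components_nonempty unfolding face_set_def by blast
    ultimately show "H \<in> {H \<in> face_set. \<exists>z\<in>H. face_indicator S z}" unfolding face_indicator_def by blast
  next
    fix H assume "H \<in> {H \<in> face_set. \<exists>z\<in>H. face_indicator S z}"
    then obtain z H' where H: "H \<in> face_set" "z \<in> H" "z \<in> H'" "H' \<in> S" unfolding face_indicator_def by blast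
    then have "H' \<in> face_set" using assms by blast
    then have "H = H'" using face_eq[OF H(1,2)] face_eq[OF _ H(3)] by simp
    then show "H \<in> S" using H(4) by simp
  qed
qed

lemma dual_multigraphs_plane:
  assumes "finite face_set"
  shows "dual_multigraphs V E h face_set dual_ends"
proof (rule dual_multigraphs.intro)
  show "finite V" "finite E" "finite face_set" by (fact finV finE assms)+
  show "h e \<subseteq> V" "card (h e) = 2" if "e \<in> E" for e by (rule h[OF that])+
  show "dual_ends e \<subseteq> face_set" "card (dual_ends e) = 2" if "e \<in> E" for e using dual_ends_card[OF that] by blast+
  show "(\<forall>v\<in>V. even (deg h Z v)) \<longleftrightarrow> (\<exists>S\<subseteq>face_set. Z = bd dual_ends E S)" if Z: "Z \<subseteq> E" for Z
  proof
    assume "\<forall>v\<in>V. even (deg h Z v)"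
    then have "\<exists>\<xi>. face_const E \<xi> \<and> Z = {e \<in> E. crossing E \<xi> e}" by (intro even_is_crossing[OF Z]) simp
    then obtain \<xi> where \<xi>: "face_const E \<xi>" "Z = {e \<in> E. crossing E \<xi> e}" by blast
    have "Z = bd dual_ends E {H \<in> face_set. \<exists>z\<in>H. \<xi> z}" unfolding bd_dual[OF \<xi>(1) refl] by (rule \<xi>(2))
    then show "\<exists>S\<subseteq>face_set. Z = bd dual_ends E S"
      by (intro exI[of _ "{H \<in> face_set. \<exists>z\<in>H. \<xi> z}"] conjI) auto
  next
    assume "\<exists>S\<subseteq>face_set. Z = bd dual_ends E S"
    then obtain S where S: "S \<subseteq> face_set" "Z = bd dual_ends E S" by blast
    note I = face_indicator[OF S(1)]
    have "\<forall>x. even (deg h {e \<in> E. crossing E (face_indicator S) e} x)"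
      by (rule crossing_even[OF order_refl, THEN spec, THEN mp, OF I(1), THEN conjunct1])
    then show "\<forall>v\<in>V. even (deg h Z v)" unfolding S(2) bd_dual[OF I] by blast
  qed
  show "S = {} \<or> S = face_set" if S: "S \<subseteq> face_set" "bd dual_ends E S = {}" for S
  proof -
    note I = face_indicator[OF S(1)]
    have none: "\<forall>e\<in>E. \<not> crossing E (face_indicator S) e" using bd_dual[OF I] S(2) by blast
    have "\<forall>a b. a \<notin> support E \<longrightarrow> b \<notin> support E \<longrightarrow> face_indicator S a = face_indicator S b"
      by (rule crossing_even[OF order_refl, THEN spec, THEN mp, OF I(1), THEN conjunct2, THEN mp, OF none])
    note c = this[rule_format]
    have sub: "H \<subseteq> - support E" "H \<noteq> {}" if "H \<in> face_set" for H
      using that in_components_subset in_components_nonempty unfolding face_set_def by blast+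
    have "H' \<in> S" if H: "H \<in> S" "H' \<in> face_set" for H H'
    proof -
      have HF: "H \<in> face_set" using H(1) S(1) by blast
      obtain z where z: "z \<in> H" "z \<notin> support E" using sub[OF HF] by blast
      obtain z' where z': "z' \<in> H'" "z' \<notin> support E" using sub[OF H(2)] by blast
      have "face_indicator S z" using z H(1) unfolding face_indicator_def by blast
      then have "face_indicator S z'" using c[OF z(2) z'(2)] by simp
      then have "H' \<in> {H \<in> face_set. \<exists>z\<in>H. face_indicator S z}" using H(2) z'(1) by blast
      then show ?thesis unfolding I(2)[symmetric] .
    qed
    then show ?thesis using S(1) by blast
  qed
qed

end

end

section \<open>Edge colouring\<close>

lemma loopless:
  assumes mg: "multigraph G" and reg: "regular_multigraph r G"
    and cuts: "\<not> (\<exists>C. odd_cut G C \<and> card C < r)" and e: "e \<in> edges G"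
  shows "card (ends G e) = 2"
proof (rule ccontr)
  assume "card (ends G e) \<noteq> 2"
  moreover have "card (ends G e) \<in> {1, 2}" "ends G e \<subseteq> verts G" "finite (edges G)"
    using mg e unfolding multigraph_def by blast+
  ultimately have "card (ends G e) = 1" by blast
  then obtain v where v: "ends G e = {v}" by (rule card_1_singletonE)
  define L where "L = {e \<in> edges G. ends G e = {v}}"
  define N where "N = {e \<in> edges G. v \<in> ends G e}"
  have V: "v \<in> verts G" using \<open>ends G e \<subseteq> verts G\<close> v by simp
  have fin: "finite L" "finite N" unfolding L_def N_def using \<open>finite (edges G)\<close> by simp_all
  have "odd_cut G (cut G {v})" unfolding odd_cut_def using V by (intro exI[of _ "{v}"]) simp
  then have ge: "r \<le> card (cut G {v})" using cuts by (meson not_le)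
  have "cut G {v} \<subseteq> N - L" unfolding cut_def N_def L_def by auto
  then have "card (cut G {v}) \<le> card (N - L)" using fin by (intro card_mono) auto
  also have "L \<subseteq> N" unfolding L_def N_def by auto
  then have "card (N - L) = card N - card L" by (rule card_Diff_subset[OF fin(1)])
  finally have "r \<le> card N - card L" using ge by simp
  moreover have "card N + card L = r"
    using reg V unfolding regular_multigraph_def degree_def N_def L_def by blast
  moreover have "card L > 0" using e v fin(1) unfolding L_def card_gt_0_iff by blast
  ultimately show False by simp
qed

lemma cut_eq_bd:
  assumes "\<And>e. e \<in> edges G \<Longrightarrow> card (ends G e) = 2"
  shows "cut G X = bd (ends G) (edges G) X"
proof -
  have "(\<exists>u v. ends G e = {u, v} \<and> u \<in> X \<and> v \<notin> X) \<longleftrightarrow> card (ends G e \<inter> X) = 1" if "e \<in> edges G" for e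
  proof -
    obtain x y where xy: "ends G e = {x, y}" "x \<noteq> y" using assms[OF \<open>e \<in> edges G\<close>] by (meson card_2_iff)
    have "(\<exists>u v. {x, y} = {u, v} \<and> u \<in> X \<and> v \<notin> X) \<longleftrightarrow> (x \<in> X) \<noteq> (y \<in> X)"
      by (auto simp: doubleton_eq_iff)
    then show ?thesis unfolding xy card_2_Int_eq_1[OF xy(2)] .
  qed
  then show ?thesis unfolding cut_def bd_def by blast
qed

text \<open>A bridge is a cut with one edge. By the handshake lemma \<open>r\<close> times the order
  of its side is odd, so the side is odd and its cut has at least \<open>r \<ge> 2\<close>
  edges.\<close>

lemma regular_bridgeless:
  assumes "finite V" "finite E" and h: "\<And>e. e \<in> E \<Longrightarrow> h e \<subseteq> V \<and> card (h e) = 2"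
    and reg: "\<And>v. v \<in> V \<Longrightarrow> deg h E v = r"
    and cuts: "\<And>X. X \<subseteq> V \<Longrightarrow> odd (card X) \<Longrightarrow> r \<le> card (bd h E X)"
    and "r \<ge> 2" and e: "e \<in> E" "h e = {u, v}"
  shows "(u, v) \<in> (adj h (E - {e}))\<^sup>*"
proof (rule ccontr)
  assume no: "(u, v) \<notin> (adj h (E - {e}))\<^sup>*"
  define R where "R = {w. (u, w) \<in> (adj h (E - {e}))\<^sup>*}"
  have h2: "card (h x) = 2" if "x \<in> E" for x using h[OF that] by blast
  have uV: "u \<in> V" using h[OF e(1)] e(2) by blast
  have "w \<in> V" if "(u, w) \<in> (adj h (E - {e}))\<^sup>*" for w
    using that by (induction rule: rtrancl_induct) (use uV h in \<open>auto simp: adj_def\<close>)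
  then have RV: "R \<subseteq> V" unfolding R_def by blast
  have uv: "u \<noteq> v" using h2[OF e(1)] e(2) by auto
  have "card (h e \<inter> R) = 1" unfolding e(2) card_2_Int_eq_1[OF uv] R_def using no by simp
  moreover have "bd h (E - {e}) R = {}" unfolding R_def by (rule bd_reach_empty) (use h2 in blast)
  ultimately have bd: "bd h E R = {e}" using e(1) unfolding bd_def by blast
  have "odd (card (bd h E R)) \<longleftrightarrow> odd (card {x \<in> R. odd (deg h E x)})"
    by (rule handshake[OF assms(2) finite_subset[OF RV assms(1)] h2])
  then have odd: "odd (card {x \<in> R. odd (deg h E x)})" unfolding bd by simp
  have "odd r"
  proof (rule ccontr)
    assume "\<not> odd r"
    then have none: "{x \<in> R. odd (deg h E x)} = {}" using reg RV by blast
    show False using odd unfolding none by simp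
  qed
  then have all: "{x \<in> R. odd (deg h E x)} = R" using reg RV by blast
  have "odd (card R)" using odd unfolding all .
  then have "r \<le> card (bd h E R)" using cuts RV by blast
  then show False using \<open>r \<ge> 2\<close> unfolding bd by simp
qed

theorem theorem10:
  fixes G :: "(complex, 'e) multigraph" and \<gamma> :: "'e \<Rightarrow> real \<Rightarrow> complex" and r :: nat
  assumes "r > 0"
    and "plane_multigraph G \<gamma>"
    and "regular_multigraph r G"
    and "\<not> (\<exists>C. odd_cut G C \<and> card C < r)"
    and "partial_three_tree (plane_dual G \<gamma>)"
  shows "edge_colorable r G"
proof -
  define V E h where "V = verts G" "E = edges G" "h = ends G"
  note defs = V_E_h_def
  have mg: "multigraph G" using assms(2) unfolding plane_multigraph_def by blast
  have finV: "finite V" and finE: "finite E" and hV: "\<And>e. e \<in> E \<Longrightarrow> h e \<subseteq> V"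
    using mg unfolding multigraph_def defs by blast+
  have h2: "card (h e) = 2" if "e \<in> E" for e using loopless[OF mg assms(3,4)] that unfolding defs by blast
  have deg: "deg h E v = r" if "v \<in> V" for v
  proof -
    have "h e \<noteq> {v}" if "e \<in> E" for e using h2[OF that] by auto
    then have "{e \<in> E. h e = {v}} = {}" by blast
    then have "degree G v = deg h E v" unfolding degree_def deg_def defs by (simp only: card.empty add_0_right)
    then show ?thesis using assms(3) that unfolding regular_multigraph_def defs by simp
  qed
  have cuts: "r \<le> card (bd h E X)" if "X \<subseteq> V" "odd (card X)" for X
  proof -
    have "odd_cut G (cut G X)" unfolding odd_cut_def using that unfolding defs by blast
    then have "r \<le> card (cut G X)" using assms(4) by (meson not_le)
    then show ?thesis using cut_eq_bd[of G X] h2 unfolding defs by simp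
  qed
  have "\<exists>c. (\<forall>e\<in>E. c e < r) \<and> (\<forall>e\<in>E. \<forall>e'\<in>E. e \<noteq> e' \<and> h e \<inter> h e' \<noteq> {} \<longrightarrow> c e \<noteq> c e')"
  \<comment> \<open>For \<open>r = 1\<close> every edge is a bridge and becomes a loop of the dual,
    so the duality does not apply; but then the edges are disjoint and one colour suffices. A vertex
    is required for changing signs in the dual.\<close>
  proof (cases "r = 1 \<or> V = {}")
    case True
    have "h e \<inter> h e' = {}" if "e \<in> E" "e' \<in> E" "e \<noteq> e'" for e e'
    proof (rule ccontr)
      assume "h e \<inter> h e' \<noteq> {}"
      then obtain v where v: "v \<in> h e" "v \<in> h e'" by blast
      then have vV: "v \<in> V" using hV that by blast
      then have "card {e \<in> E. v \<in> h e} = 1" using deg[OF vV] True unfolding deg_def by auto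
      then obtain x where x: "{e \<in> E. v \<in> h e} = {x}" by (rule card_1_singletonE)
      have "e \<in> {e \<in> E. v \<in> h e}" "e' \<in> {e \<in> E. v \<in> h e}" using that v by simp_all
      then show False using that(3) unfolding x by simp
    qed
    then show ?thesis using assms(1) by (intro exI[of _ "\<lambda>_. 0"]) blast
  next
    case False
    then have r2: "r \<ge> 2" and Vne: "V \<noteq> {}" using assms(1) by auto
    interpret plane_graph V E h \<gamma>
    proof
      show "finite V" "finite E" by (fact finV finE)+
      fix e assume e: "e \<in> E"
      have pm: "simple_path (\<gamma> e)" "{pathstart (\<gamma> e), pathfinish (\<gamma> e)} = h e" "\<gamma> e ` {0<..<1} \<inter> V = {}"
        using assms(2) e unfolding plane_multigraph_def defs by blast+
      show "h e \<subseteq> V" "card (h e) = 2" using hV h2 e by blast+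
      have "pathfinish (\<gamma> e) \<noteq> pathstart (\<gamma> e)" using h2[OF e] unfolding pm(2)[symmetric] by auto
      then show "arc (\<gamma> e)" using pm(1) simple_path_eq_arc by blast
      show "{pathstart (\<gamma> e), pathfinish (\<gamma> e)} = h e" "\<gamma> e ` {0<..<1} \<inter> V = {}" by (fact pm)+
      show "\<gamma> e ` {0<..<1} \<inter> path_image (\<gamma> e') = {}" if "e' \<in> E" "e' \<noteq> e" for e'
        using assms(2) e that unfolding plane_multigraph_def defs by blast
    qed
    have hh: "h e \<subseteq> V \<and> card (h e) = 2" if "e \<in> E" for e using hV[OF that] h2[OF that] by blast
    have bridgeless: "(u, v) \<in> (adj h (E - {e}))\<^sup>*" if "e \<in> E" "h e = {u, v}" for e u v
      by (rule regular_bridgeless[OF finV finE hh deg cuts r2 that])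
    have "img = (\<lambda>e. path_image (\<gamma> e))" by (rule ext) (rule img_def)
    then have faces: "faces G \<gamma> = face_set"
      unfolding faces_def face_set_def support_def defs[symmetric] by simp
    obtain W :: "nat set" and D f where T: "three_tree W D \<and> inj_on f (verts (plane_dual G \<gamma>)) \<and>
        f ` verts (plane_dual G \<gamma>) \<subseteq> W \<and> (\<forall>e \<in> edges (plane_dual G \<gamma>). \<forall>u v.
        ends (plane_dual G \<gamma>) e = {u, v} \<and> u \<noteq> v \<longrightarrow> {f u, f v} \<in> D)"
      using assms(5)[unfolded partial_three_tree_def] by (elim exE)
    have dual: "verts (plane_dual G \<gamma>) = face_set" "edges (plane_dual G \<gamma>) = E" "ends (plane_dual G \<gamma>) = dual_ends"
      unfolding plane_dual_def faces dual_ends_def opn_def defs[symmetric] by simp_all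
    note tree = T[THEN conjunct1] and f = T[unfolded dual, THEN conjunct2, THEN conjunct1]
      T[unfolded dual, THEN conjunct2, THEN conjunct2, THEN conjunct1]
      T[unfolded dual, THEN conjunct2, THEN conjunct2, THEN conjunct2]
    \<comment> \<open>Finiteness of the number of faces is read off from the 3-tree that contains
      the dual.\<close>
    have "finite W" using three_tree_props[OF tree] by blast
    then have fin: "finite face_set" using f(1,2) by (meson finite_imageD finite_subset)
    have plane_duality: "dual_multigraphs V E h face_set dual_ends" by (rule dual_multigraphs_plane[OF bridgeless fin])
    have cut_ne: "bd h E X \<noteq> {}" if "X \<subseteq> V" "odd (card X)" for X using cuts[OF that] r2 by auto
    obtain J where J: "J \<subseteq> E" "\<forall>v\<in>V. odd (deg h J v)" by (rule join_exists[OF finV finE hh cut_ne])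
    interpret dual_multigraphs V E h face_set dual_ends by (rule plane_duality)
    interpret odd_cut_bounded V E h face_set dual_ends r J
      by unfold_locales (use r2 deg cuts Vne J in blast)+
    show ?thesis using edge_coloring[OF tree f(1,2)] f(3) by blast
  qed
  then show ?thesis unfolding edge_colorable_def defs .
qed

end
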